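(* Let $n\geq1$, $\lambda>0$, and let $K\subset\mathbb{R}^{n+1}$ be a $\lambda$-concave convex body. Let $S_\lambda\subset\mathbb{R}^{n+1}$ be a $\lambda$-sausage body with $\operatorname{diam}(K)=\operatorname{diam}(S_\lambda)$. Then $W_i(K)\geq W_i(S_\lambda)$ for every $i\in\{0,1,\dots,n\}$. Moreover, equality holds if and only if $K$ is a $\lambda$-sausage body.
   Context: A convex body is a compact convex set with non-empty interior; balls are closed. For $\lambda>0$, a convex body $K\subset\mathbb{R}^{n+1}$ is $\lambda$-concave if for every $p\in\partial K$ there is a ball of radius $1/\lambda$ whose boundary passes through $p$ and which, intersected with some open neighborhood $U(p)$ of $p$, is contained in $K\cap U(p)$. A $\lambda$-sausage body is the convex hull of two (possibly coinciding) balls of radius $1/\lambda$. $\operatorname{diam}(K)=\max_{p,q\in K}|pq|$. The quermassintegrals $W_i(K)$ are defined by the Steiner formula $\mathrm{Vol}_{n+1}(K+tB)=\sum_{i=0}^{n+1}\binom{n+1}{i}W_i(K)t^i$, $t\geq0$, with $B$ the unit ball and $+$ Minkowski addition. *)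

theory Defs
  imports "HOL-Analysis.Analysis"
begin

definition convex_body :: "'a::euclidean_space set \<Rightarrow> bool" where
  "convex_body K \<longleftrightarrow> compact K \<and> convex K \<and> interior K \<noteq> {}"

definition lambda_concave :: "real \<Rightarrow> 'a::euclidean_space set \<Rightarrow> bool" where
  "lambda_concave lam K \<longleftrightarrow>
     (\<forall>p\<in>frontier K. \<exists>c. p \<in> sphere c (1/lam) \<and>
        (\<exists>U. open U \<and> p \<in> U \<and> cball c (1/lam) \<inter> U \<subseteq> K \<inter> U))"

definition sausage_body :: "real \<Rightarrow> 'a::euclidean_space set \<Rightarrow> bool" where
  "sausage_body lam S \<longleftrightarrow>
     (\<exists>a b. S = convex hull (cball a (1/lam) \<union> cball b (1/lam)))"

definition parallel_body :: "'a::euclidean_space set \<Rightarrow> real \<Rightarrow> 'a set" where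
  "parallel_body K t = {x + y | x y. x \<in> K \<and> y \<in> cball 0 t}"

text \<open>Quermassintegrals via the Steiner formula in dimension N = DIM('a) (= n+1):
  Vol(K + tB) = sum_{i=0}^{N} (N choose i) W_i(K) t^i for all t >= 0.
  The coefficient vector (indices 0..N; set to 0 beyond N) is unique.\<close>
definition quermass :: "'a::euclidean_space set \<Rightarrow> nat \<Rightarrow> real" where
  "quermass K = (THE w. (\<forall>i>DIM('a). w i = 0) \<and>
      (\<forall>t\<ge>0. measure lebesgue (parallel_body K t) =
          (\<Sum>i\<le>DIM('a). real (DIM('a) choose i) * w i * t ^ i)))"

end

theory Submission
  imports Defs
begin

text \<open>
  By Blaschke's rolling theorem a \<open>\<lambda>\<close>-concave body is \<open>K = L + rB\<close> with \<open>r = 1/\<lambda>\<close> and \<open>L\<close> compact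
  convex: the function \<open>h - r |.|\<close>, with \<open>h\<close> the support function of \<open>K\<close>, has local linear supports
  in every direction, hence it is convex. A sausage body is \<open>I + rB\<close> with \<open>I\<close> a segment, and equality
  of the diameters of \<open>K\<close> and \<open>S\<close> says that \<open>L\<close> contains a segment \<open>I\<close> with \<open>diam L = diam I\<close>.

  Let \<open>N\<close> be the dimension. The volume of \<open>L + tB\<close> is a polynomial in \<open>t\<close> with nonnegative
  coefficients: the volume is affine when a segment is added, so this holds for a zonotope (a finite
  sum of segments) in place of \<open>B\<close>, and \<open>B\<close> is a limit of zonotopes. For a segment the polynomial has
  only the terms \<open>\<omega> t^N\<close> and \<open>c |I| t^(N-1)\<close> with \<open>c > 0\<close>. In general the coefficient of \<open>t^(N-1)\<close> is
  at least \<open>c\<close> times half the perimeter of any triangle in \<open>L\<close>, and thus larger than \<open>c |I|\<close>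
  unless \<open>L = I\<close>. Expanding at \<open>t + r\<close> distributes this coefficient with positive weights to
  \<open>W_0, ..., W_(N-1)\<close>.
\<close>

subsection \<open>Volumes swept along segments\<close>

text \<open>An inequality between two polynomials on t > 0 does not order their coefficients, and
  the inclusion of \<open>I\<close> in \<open>L\<close> alone gives no equality case. So the
  comparison is made coefficient by coefficient: nonnegativity settles every degree at which the
  segment contributes 0, the leading coefficients agree, and once they agree the behaviour for large
  t compares the coefficients of t^(N-1). Only this last degree needs geometry, and strictness there
  comes from the strict triangle inequality for a third point of \<open>L\<close> off
  \<open>I\<close>. Zonotopes approximate the ball because norm x is a constant multiple of the
  integral of |x . u| over u in the unit ball, and a Riemann sum of this integral is the support
  function of a zonotope. Rotation invariance enters only through reflections, which already act
  transitively on spheres. In the rolling theorem local supports exist only at nonzero directions,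
  so they are glued along segments that miss the origin. Opposite directions are reached by a
  perturbation, which requires dimension at least 2.\<close>

definition compact_convex :: "'a::euclidean_space set \<Rightarrow> bool" where
  "compact_convex K \<longleftrightarrow> compact K \<and> convex K \<and> K \<noteq> {}"

lemma compact_set_plus:
  fixes S T :: "'a::real_normed_vector set"
  assumes "compact S" "compact T"
  shows "compact (S + T)"
proof -
  have "S + T = {x + y | x y. x \<in> S \<and> y \<in> T}"
    by (auto simp: set_plus_def)
  then show ?thesis using compact_sums[OF assms] by simp
qed

lemma compact_convex_plus:
  "compact_convex K \<Longrightarrow> compact_convex L \<Longrightarrow> compact_convex (K + L)"
  unfolding compact_convex_def
  using compact_set_plus convex_set_plus set_plus_intro by blast

lemma compact_convex_singleton: "compact_convex {x}"
  by (simp add: compact_convex_def)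

lemma compact_convex_cball: "0 \<le> t \<Longrightarrow> compact_convex (cball x t)"
  by (simp add: compact_convex_def)

lemma compact_convex_scaleR_interval:
  "a \<le> b \<Longrightarrow> compact_convex ((\<lambda>t. t *\<^sub>R w) ` {a..b})"
  unfolding compact_convex_def
  by (auto intro!: compact_continuous_image continuous_intros convex_linear_image
      simp: linear_iff algebra_simps)

definition segm :: "'a::euclidean_space \<Rightarrow> 'a set" where
  "segm w = (\<lambda>t. t *\<^sub>R w) ` {-1..1}"

lemma compact_convex_segm: "compact_convex (segm w)"
  unfolding segm_def by (rule compact_convex_scaleR_interval) simp

lemma segm_scaleR: "0 \<le> s \<Longrightarrow> segm (s *\<^sub>R w) = (\<lambda>t. t *\<^sub>R w) ` {-s..s}"
proof -
  assume s: "0 \<le> s"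
  have "(\<lambda>t. t * s) ` {-1..1} = {-s..s}"
    using image_mult_atLeastAtMost_if'[of s "-1" 1] s by auto
  then have "(\<lambda>t. t *\<^sub>R w) ` {-s..s} = (\<lambda>t. t *\<^sub>R w) ` ((\<lambda>t. t * s) ` {-1..1})" by simp
  also have "\<dots> = segm (s *\<^sub>R w)"
    by (simp add: segm_def image_image)
  finally show ?thesis by simp
qed

lemma compact_convex_lmeasurable: "compact_convex K \<Longrightarrow> K \<in> lmeasurable"
  by (simp add: compact_convex_def lmeasurable_compact)

lemma measure_mono_compact_convex:
  "compact_convex K \<Longrightarrow> compact_convex L \<Longrightarrow> K \<subseteq> L \<Longrightarrow>
    measure lebesgue K \<le> measure lebesgue L"
  by (rule measure_mono_fmeasurable) (auto simp: compact_convex_lmeasurable fmeasurableD)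

text \<open>Cauchy's functional equation. Monotonicity traps \<open>e (n * s)\<close> between the
  values at two consecutive integers, so n times the error stays below \<open>e 1\<close> for every
  n.\<close>

lemma additive_mono_imp_linear:
  fixes e :: "real \<Rightarrow> real"
  assumes add: "\<And>x y. 0 \<le> x \<Longrightarrow> 0 \<le> y \<Longrightarrow> e (x + y) = e x + e y"
    and mono: "\<And>x y. 0 \<le> x \<Longrightarrow> x \<le> y \<Longrightarrow> e x \<le> e y"
    and s: "0 \<le> s"
  shows "e s = s * e 1"
proof -
  have mult: "e (real n * x) = real n * e x" if "0 \<le> x" for n x
  proof (induction n)
    case 0
    show ?case using add[of 0 0] by simp
  next
    case (Suc n)
    have "e (real (Suc n) * x) = e (real n * x + x)" by (simp add: algebra_simps)
    also have "\<dots> = e (real n * x) + e x" using that by (intro add) auto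
    finally show ?case using Suc by (simp add: algebra_simps)
  qed
  have e1: "0 \<le> e 1" using mono[of 0 1] mult[of 0 0] by simp
  have bound: "real n * \<bar>e s - s * e 1\<bar> \<le> e 1" for n
  proof -
    define m where "m = nat \<lfloor>real n * s\<rfloor>"
    have m: "real m \<le> real n * s" "real n * s \<le> real (Suc m)"
      using s unfolding m_def by (auto simp: of_nat_nat) linarith
    have "real m * e 1 \<le> real n * e s"
      using mono[of "real m" "real n * s"] m mult[of 1 m] mult[of s n] s by simp
    moreover have "real n * e s \<le> real (Suc m) * e 1"
      using mono[of "real n * s" "real (Suc m)"] m mult[of 1 "Suc m"] mult[of s n] s by simp
    moreover have "real m * e 1 \<le> real n * s * e 1" "real n * s * e 1 \<le> real (Suc m) * e 1"
      using m e1 by (auto intro: mult_right_mono simp del: of_nat_Suc)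
    ultimately have "\<bar>real n * e s - real n * s * e 1\<bar> \<le> e 1"
      by (simp add: algebra_simps abs_le_iff)
    moreover have "real n * \<bar>e s - s * e 1\<bar> = \<bar>real n * e s - real n * s * e 1\<bar>"
    proof -
      have "real n * e s - real n * s * e 1 = real n * (e s - s * e 1)"
        by (simp add: right_diff_distrib)
      then show ?thesis by (simp only: abs_mult abs_of_nat)
    qed
    ultimately show ?thesis by simp
  qed
  have "\<bar>e s - s * e 1\<bar> = 0"
  proof (rule ccontr)
    assume "\<bar>e s - s * e 1\<bar> \<noteq> 0"
    then have "0 < \<bar>e s - s * e 1\<bar>" by simp
    then obtain n where "e 1 < real n * \<bar>e s - s * e 1\<bar>"
      using ex_less_of_nat_mult by blast
    with bound[of n] show False by simp
  qed
  then show ?thesis by simp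
qed

lemma measure_translation_singleton:
  "measure lebesgue (K + {a}) = measure lebesgue (K :: 'a::euclidean_space set)"
proof -
  have "K + {a} = (+) a ` K" by (auto simp: set_plus_def add.commute)
  then show ?thesis by (simp add: measure_translation)
qed

text \<open>Sliding \<open>K\<close> along \<open>w\<close>: the pieces swept over \<open>[0,x]\<close> and \<open>[x,x+y]\<close> overlap, by convexity,
  in exactly one translate of \<open>K\<close>; hence the swept volume is an affine function of the length.\<close>

lemma measure_sweep_affine:
  fixes K :: "'a::euclidean_space set"
  assumes K: "compact_convex K"
  shows "\<exists>D. \<forall>s\<ge>0. measure lebesgue (K + segm (s *\<^sub>R w)) = measure lebesgue K + s * D"
proof -
  define E where "E a b = K + (\<lambda>t. t *\<^sub>R w) ` {a..b}" for a b :: real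
  have mem: "z \<in> E a b \<longleftrightarrow> (\<exists>k\<in>K. \<exists>t\<in>{a..b}. z = k + t *\<^sub>R w)" for z a b
    by (auto simp: E_def set_plus_def)
  have cc: "compact_convex (E a b)" if "a \<le> b" for a b
    unfolding E_def using K that by (intro compact_convex_plus compact_convex_scaleR_interval)
  have shift: "E (a + c) (b + c) = E a b + {c *\<^sub>R w}" for a b c
  proof -
    have "{a + c..b + c} = (\<lambda>t. t + c) ` {a..b}" by simp
    then have "(\<lambda>t. t *\<^sub>R w) ` {a + c..b + c} = (\<lambda>t. t *\<^sub>R w) ` {a..b} + {c *\<^sub>R w}"
      by (auto simp: image_image scaleR_add_left set_plus_def simp del: image_add_atLeastAtMost')
    then show ?thesis by (simp add: E_def add.assoc)
  qed
  have un: "E 0 (x + y) = E 0 x \<union> E x (x + y)" if "0 \<le> x" "0 \<le> y" for x y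
  proof -
    have "{0..x + y} = {0..x} \<union> {x..x+y}" using that by auto
    then show ?thesis by (simp add: E_def image_Un set_plus_Un)
  qed
  have int: "E 0 x \<inter> E x (x + y) = E x x" if "0 \<le> x" "0 \<le> y" for x y
  proof
    show "E x x \<subseteq> E 0 x \<inter> E x (x + y)" using that by (fastforce simp: mem)
    show "E 0 x \<inter> E x (x + y) \<subseteq> E x x"
    proof
      fix z assume "z \<in> E 0 x \<inter> E x (x + y)"
      then obtain k l a b where k: "k \<in> K" "0 \<le> a" "a \<le> x" "z = k + a *\<^sub>R w"
        and l: "l \<in> K" "x \<le> b" "z = l + b *\<^sub>R w" by (auto simp: mem)
      have "x \<in> closed_segment a b" using k l by (simp add: closed_segment_eq_real_ivl)
      then obtain u where u: "0 \<le> u" "u \<le> 1" "x = (1 - u) * a + u * b"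
        by (auto simp: in_segment)
      have "(1 - u) *\<^sub>R k + u *\<^sub>R l \<in> K"
        using K k l u unfolding compact_convex_def by (simp add: convexD_alt)
      moreover have "z = ((1 - u) *\<^sub>R k + u *\<^sub>R l) + x *\<^sub>R w"
      proof -
        have "z = (1 - u) *\<^sub>R z + u *\<^sub>R z" by (simp add: algebra_simps)
        also have "\<dots> = (1 - u) *\<^sub>R (k + a *\<^sub>R w) + u *\<^sub>R (l + b *\<^sub>R w)" using k l by metis
        also have "\<dots> = ((1 - u) *\<^sub>R k + u *\<^sub>R l) + x *\<^sub>R w" by (simp add: u(3) algebra_simps)
        finally show ?thesis .
      qed
      ultimately show "z \<in> E x x" by (auto simp: mem)
    qed
  qed
  define G where "G x = measure lebesgue (E 0 x)" for x
  have Gsh: "measure lebesgue (E a (a + x)) = G x" for a x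
    using shift[of 0 a x] by (simp add: G_def measure_translation_singleton add.commute)
  have G0: "G 0 = measure lebesgue K" by (simp add: G_def E_def)
  have Gadd: "G (x + y) - G 0 = (G x - G 0) + (G y - G 0)" if xy: "0 \<le> x" "0 \<le> y" for x y
  proof -
    have "G (x + y) + measure lebesgue (E 0 x \<inter> E x (x + y))
        = measure lebesgue (E 0 x) + measure lebesgue (E x (x + y))"
      unfolding G_def un[OF xy]
      using cc xy by (subst measure_Un3) (auto simp: compact_convex_lmeasurable)
    then show ?thesis using int[OF xy] Gsh[of x 0] Gsh[of x y] by (simp add: G_def)
  qed
  have Gmono: "G x \<le> G y" if "0 \<le> x" "x \<le> y" for x y
    unfolding G_def using cc that
    by (intro measure_mono_compact_convex) (auto simp: mem subset_iff, force)
  have lin: "G x - G 0 = x * (G 1 - G 0)" if "0 \<le> x" for x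
    using additive_mono_imp_linear[of "\<lambda>x. G x - G 0" x] Gadd Gmono that by simp
  show ?thesis
  proof (intro exI allI impI)
    fix s :: real assume s: "0 \<le> s"
    have "K + segm (s *\<^sub>R w) = E (-s) (-s + 2 * s)" by (simp add: segm_scaleR[OF s] E_def)
    then have "measure lebesgue (K + segm (s *\<^sub>R w)) = G (2 * s)" by (simp only: Gsh)
    then show "measure lebesgue (K + segm (s *\<^sub>R w)) = measure lebesgue K + s * (2 * (G 1 - G 0))"
      using lin[of "2 * s"] s G0 by (simp add: algebra_simps)
  qed
qed

text \<open>Only these two properties of volume enter the polynomial expansion, and unlike volume
  itself the class they define is closed under the difference operator \<open>dirdiff\<close>. The
  slope may depend on the set and on the direction.\<close>

definition polyaffine :: "('a::euclidean_space set \<Rightarrow> real) \<Rightarrow> bool" where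
  "polyaffine f \<longleftrightarrow> (\<forall>K. compact_convex K \<longrightarrow> 0 \<le> f K \<and>
     (\<forall>w. \<exists>D. \<forall>s\<ge>0. f (K + segm (s *\<^sub>R w)) = f K + s * D))"

lemma polyaffine_measure: "polyaffine (measure lebesgue)"
  by (simp add: polyaffine_def measure_sweep_affine)

lemma polyaffine_zero: "polyaffine (\<lambda>K. 0)"
  by (auto simp: polyaffine_def)

lemma polyaffine_add:
  assumes "polyaffine f" "polyaffine g"
  shows "polyaffine (\<lambda>K. f K + g K)"
  unfolding polyaffine_def
proof (intro allI impI conjI)
  fix K :: "'a set" and w assume K: "compact_convex K"
  show "0 \<le> f K + g K" using assms K by (simp add: polyaffine_def)
  obtain D E where "\<forall>s\<ge>0. f (K + segm (s *\<^sub>R w)) = f K + s * D"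
    "\<forall>s\<ge>0. g (K + segm (s *\<^sub>R w)) = g K + s * E"
    using assms K unfolding polyaffine_def by meson
  then show "\<exists>D. \<forall>s\<ge>0. f (K + segm (s *\<^sub>R w)) + g (K + segm (s *\<^sub>R w)) = f K + g K + s * D"
    by (intro exI[of _ "D + E"]) (auto simp: algebra_simps)
qed

definition dirdiff :: "'a \<Rightarrow> ('a::euclidean_space set \<Rightarrow> real) \<Rightarrow> 'a set \<Rightarrow> real" where
  "dirdiff w f K = f (K + segm w) - f K"

lemma polyaffine_dirdiff:
  assumes "polyaffine f" "compact_convex K" "0 \<le> s"
  shows "f (K + segm (s *\<^sub>R w)) = f K + s * dirdiff w f K"
proof -
  obtain D where D: "\<forall>s\<ge>0. f (K + segm (s *\<^sub>R w)) = f K + s * D"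
    using assms unfolding polyaffine_def by blast
  from D have "f (K + segm (1 *\<^sub>R w)) = f K + 1 * D" by (metis zero_le_one)
  then show ?thesis using D assms(3) by (simp add: dirdiff_def)
qed

text \<open>A function that is affine and nonnegative on a half-line cannot have negative slope,
  which gives nonnegativity; affinity follows because adding two segments commutes. Iterated
  differences are therefore nonnegative too.\<close>

lemma polyaffine_polyaffine_dirdiff:
  assumes f: "polyaffine f"
  shows "polyaffine (dirdiff w f)"
  unfolding polyaffine_def
proof (intro allI impI conjI)
  fix K :: "'a set" and v assume K: "compact_convex K"
  show "0 \<le> dirdiff w f K"
  proof (rule ccontr)
    assume neg: "\<not> 0 \<le> dirdiff w f K"
    \<comment> \<open>With negative slope, the affine function would reach the value -1 at this
      \<open>s\<close>.\<close>
    define s where "s = (f K + 1) / (- dirdiff w f K)"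
    have fK: "0 \<le> f K" using f K by (simp add: polyaffine_def)
    have s: "0 \<le> s" using neg fK by (simp add: s_def divide_nonneg_neg)
    have "0 \<le> f (K + segm (s *\<^sub>R w))"
      using f compact_convex_plus[OF K compact_convex_segm] by (simp add: polyaffine_def)
    also have "\<dots> = f K + s * dirdiff w f K" using polyaffine_dirdiff[OF f K s] .
    also have "\<dots> = -1" using neg by (simp add: s_def)
    finally show False by simp
  qed
  have "dirdiff w f (K + segm (s *\<^sub>R v))
      = dirdiff w f K + s * (dirdiff v f (K + segm w) - dirdiff v f K)" if s: "0 \<le> s" for s
  proof -
    have "K + segm (s *\<^sub>R v) + segm w = (K + segm w) + segm (s *\<^sub>R v)"
      by (simp add: ac_simps)
    then show ?thesis
      using polyaffine_dirdiff[OF f K s, of v]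
        polyaffine_dirdiff[OF f compact_convex_plus[OF K compact_convex_segm] s, of w v]
      by (simp add: dirdiff_def[of w] algebra_simps)
  qed
  then show "\<exists>D. \<forall>s\<ge>0. dirdiff w f (K + segm (s *\<^sub>R v)) = dirdiff w f K + s * D" by blast
qed

lemma compact_convex_sum_segm: "compact_convex (\<Sum>j\<in>J. segm (w j))"
proof (induction J rule: infinite_finite_induct)
  case (insert x F)
  then show ?case by (simp add: compact_convex_plus compact_convex_segm)
qed (auto simp: compact_convex_singleton)

text \<open>Peeling off one segment replaces \<open>f\<close> by \<open>f\<close> plus t times
  \<open>dirdiff (w x) f\<close> on the remaining zonotope, so the induction must range over all
  polyaffine \<open>f\<close>. Keeping the coefficients polyaffine makes them nonnegative. The
  degree is bounded only by the number of segments at this stage.\<close>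

lemma polyaffine_zonotope_polynomial:
  fixes f :: "'a::euclidean_space set \<Rightarrow> real" and J :: "'j set"
  assumes "finite J" "polyaffine f"
  shows "\<exists>c. (\<forall>i. polyaffine (c i)) \<and> (\<forall>K t. compact_convex K \<longrightarrow> 0 \<le> t \<longrightarrow>
      f (K + (\<Sum>j\<in>J. segm (t *\<^sub>R w j))) = (\<Sum>i\<le>card J. c i K * t ^ i))"
  using assms
proof (induction J arbitrary: f rule: finite_induct)
  case empty
  then show ?case by (intro exI[of _ "\<lambda>i. f"]) simp
next
  case (insert x F)
  let ?Z = "\<lambda>t. \<Sum>j\<in>F. segm (t *\<^sub>R w j)"
  obtain c where c: "\<And>i. polyaffine (c i)"
    "\<And>K t. compact_convex K \<Longrightarrow> 0 \<le> t \<Longrightarrow> f (K + ?Z t) = (\<Sum>i\<le>card F. c i K * t ^ i)"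
    using insert.IH[OF insert.prems] by blast
  obtain d where d: "\<And>i. polyaffine (d i)"
    "\<And>K t. compact_convex K \<Longrightarrow> 0 \<le> t \<Longrightarrow>
      dirdiff (w x) f (K + ?Z t) = (\<Sum>i\<le>card F. d i K * t ^ i)"
    using insert.IH[OF polyaffine_polyaffine_dirdiff[OF insert.prems, of "w x"]] by blast
  \<comment> \<open>\<open>c'\<close> pads with zero at the new top index, and \<open>d'\<close>
    moves every coefficient up one degree to absorb the factor t.\<close>
  define c' where "c' i = (if i \<le> card F then c i else (\<lambda>K. 0))" for i
  define d' where "d' i = (case i of 0 \<Rightarrow> (\<lambda>K. 0) | Suc k \<Rightarrow> d k)" for i
  show ?case
  proof (intro exI[of _ "\<lambda>i K. c' i K + d' i K"] conjI allI impI)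
    show "polyaffine (\<lambda>K. c' i K + d' i K)" for i
      using c d by (intro polyaffine_add) (auto simp: c'_def d'_def polyaffine_zero split: nat.split)
    fix K :: "'a set" and t :: real assume K: "compact_convex K" and t: "0 \<le> t"
    have "f (K + (\<Sum>j\<in>insert x F. segm (t *\<^sub>R w j))) = f ((K + ?Z t) + segm (t *\<^sub>R w x))"
      using insert.hyps by (simp add: ac_simps)
    also have "\<dots> = f (K + ?Z t) + t * dirdiff (w x) f (K + ?Z t)"
      using insert.prems K t
      by (intro polyaffine_dirdiff compact_convex_plus compact_convex_sum_segm)
    also have "\<dots> = (\<Sum>i\<le>card F. c' i K * t ^ i) + (\<Sum>i\<le>card F. d' (Suc i) K * t ^ Suc i)"
      using c(2)[OF K t] d(2)[OF K t] by (simp add: c'_def d'_def sum_distrib_left ac_simps)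
    also have "(\<Sum>i\<le>card F. c' i K * t ^ i) = (\<Sum>i\<le>Suc (card F). c' i K * t ^ i)"
      by (simp add: c'_def)
    also have "(\<Sum>i\<le>card F. d' (Suc i) K * t ^ Suc i) = (\<Sum>i\<le>Suc (card F). d' i K * t ^ i)"
      unfolding sum.atMost_Suc_shift[of _ "card F"] by (simp add: d'_def)
    finally show "f (K + (\<Sum>j\<in>insert x F. segm (t *\<^sub>R w j)))
        = (\<Sum>i\<le>card (insert x F). (c' i K + d' i K) * t ^ i)"
      using insert.hyps by (simp add: sum.distrib distrib_right algebra_simps)
  qed
qed

subsection \<open>The ball as a limit of zonotopes\<close>

lemma inner_le_sum_segm:
  assumes "finite J" "z \<in> (\<Sum>j\<in>J. segm (w j))"
  shows "x \<bullet> z \<le> (\<Sum>j\<in>J. \<bar>x \<bullet> w j\<bar>)"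
  using assms
proof (induction J arbitrary: z rule: finite_induct)
  case (insert j J)
  then obtain a b where ab: "z = a + b" "a \<in> segm (w j)" "b \<in> (\<Sum>j\<in>J. segm (w j))"
    by (auto simp: set_plus_def)
  from ab(2) obtain t where "t \<in> {-1..1}" and t: "a = t *\<^sub>R w j" "\<bar>t\<bar> \<le> 1"
    unfolding segm_def by fastforce
  have "x \<bullet> a \<le> \<bar>x \<bullet> w j\<bar>"
  proof -
    have "x \<bullet> a \<le> \<bar>t\<bar> * \<bar>x \<bullet> w j\<bar>" 
      unfolding t(1) inner_scaleR_right abs_mult[symmetric] by (rule abs_ge_self)
    also have "\<dots> \<le> 1 * \<bar>x \<bullet> w j\<bar>" using t by (intro mult_right_mono) auto
    finally show ?thesis by simp
  qed
  then show ?case using insert ab by (fastforce simp: inner_add_right)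
qed auto

lemma sum_segm_attains_inner:
  assumes "finite J"
  shows "\<exists>z\<in>(\<Sum>j\<in>J. segm (w j)). x \<bullet> z = (\<Sum>j\<in>J. \<bar>x \<bullet> w j\<bar>)"
  using assms
proof (induction J rule: finite_induct)
  case (insert j J)
  then obtain b where b: "b \<in> (\<Sum>j\<in>J. segm (w j))" "x \<bullet> b = (\<Sum>j\<in>J. \<bar>x \<bullet> w j\<bar>)" by blast
  have "sgn (x \<bullet> w j) *\<^sub>R w j \<in> segm (w j)"
    unfolding segm_def by (intro imageI) (simp add: sgn_if)
  moreover have "x \<bullet> (sgn (x \<bullet> w j) *\<^sub>R w j) = \<bar>x \<bullet> w j\<bar>" by (simp add: sgn_if)
  ultimately show ?case using b insert.hyps
    by (intro bexI[of _ "sgn (x \<bullet> w j) *\<^sub>R w j + b"]) (auto simp: inner_add_right)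
qed auto

text \<open>The sum of the |x . w j| is the support function of the zonotope, so the hypotheses
  compare it with the support functions of two balls. The inner inclusion needs a separating
  hyperplane; for the outer one the direction x = z suffices.\<close>

lemma zonotope_between_balls:
  fixes w :: "'j \<Rightarrow> 'a::euclidean_space"
  assumes J: "finite J"
    and lo: "\<And>x. a * norm x \<le> (\<Sum>j\<in>J. \<bar>x \<bullet> w j\<bar>)"
    and hi: "\<And>x. (\<Sum>j\<in>J. \<bar>x \<bullet> w j\<bar>) \<le> b * norm x" and "0 \<le> b"
  shows "cball 0 a \<subseteq> (\<Sum>j\<in>J. segm (w j))" "(\<Sum>j\<in>J. segm (w j)) \<subseteq> cball 0 b"
proof -
  let ?Z = "\<Sum>j\<in>J. segm (w j)"
  show "cball 0 a \<subseteq> ?Z"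
  proof (rule ccontr)
    assume "\<not> cball 0 a \<subseteq> ?Z"
    then obtain y where "y \<in> cball 0 a" and "y \<notin> ?Z" by blast
    then have y: "norm y \<le> a" "y \<notin> ?Z" by (simp_all add: dist_norm)
    have Z: "convex ?Z" "closed ?Z"
      using compact_convex_sum_segm[of w J] by (auto simp: compact_convex_def compact_imp_closed)
    obtain v \<beta> where v: "v \<bullet> y < \<beta>" "\<And>z. z \<in> ?Z \<Longrightarrow> \<beta> < v \<bullet> z"
      using separating_hyperplane_closed_point[OF Z y(2)] by blast
    obtain z where z: "z \<in> ?Z" "(-v) \<bullet> z = (\<Sum>j\<in>J. \<bar>(-v) \<bullet> w j\<bar>)"
      using sum_segm_attains_inner[OF J, where x="-v"] by blast
    have "a * norm (-v) \<le> (-v) \<bullet> z" using lo[of "-v"] z(2) by simp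
    also have "\<dots> < (-v) \<bullet> y" using v(1) v(2)[OF z(1)] by simp
    also have "\<dots> \<le> norm (-v) * norm y" by (rule norm_cauchy_schwarz)
    also have "\<dots> \<le> norm (-v) * a" using y(1) by (intro mult_left_mono) auto
    finally show False by (simp add: mult.commute)
  qed
  show "?Z \<subseteq> cball 0 b"
  proof
    fix z assume z: "z \<in> ?Z"
    have "norm z * norm z = z \<bullet> z" by (simp add: dot_square_norm power2_eq_square)
    also have "\<dots> \<le> b * norm z" using inner_le_sum_segm[OF J z, of z] hi[of z] by simp
    finally show "z \<in> cball 0 b" using \<open>0 \<le> b\<close> by (cases "z = 0") auto
  qed
qed

section \<open>Reflections and the invariance of Lebesgue measure\<close>

definition reflection_along :: "'a::euclidean_space \<Rightarrow> 'a \<Rightarrow> 'a" where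
  "reflection_along w x = x - (2 * (x \<bullet> w) / (w \<bullet> w)) *\<^sub>R w"

lemma linear_reflection_along: "linear (reflection_along w)"
  by (auto simp: linear_iff reflection_along_def inner_add_left algebra_simps add_divide_distrib)

lemma reflection_along_involution [simp]: "reflection_along w (reflection_along w x) = x"
  by (cases "w = 0") (simp_all add: reflection_along_def inner_diff_left)

lemma inj_reflection_along: "inj (reflection_along w)"
  by (metis injI reflection_along_involution)

lemma inner_reflection_along: "reflection_along w x \<bullet> y = x \<bullet> reflection_along w y"
  by (simp add: reflection_along_def inner_diff_left inner_diff_right inner_commute)

lemma norm_reflection_along [simp]: "norm (reflection_along w x) = norm x"
  by (simp add: norm_eq inner_reflection_along)

text \<open>Transitivity on spheres: any function invariant under all reflections depends on the
  norm alone. This is what the invariance results below are used for.\<close>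

lemma reflection_along_diff:
  assumes "norm a = norm b" shows "reflection_along (a - b) a = b"
proof (cases "a = b")
  case False
  have eq: "a \<bullet> a = b \<bullet> b" using assms by (simp add: norm_eq)
  then have "(a - b) \<bullet> (a - b) = 2 * (a \<bullet> (a - b))"
    by (simp add: inner_diff_left inner_diff_right inner_commute)
  moreover have "(a - b) \<bullet> (a - b) \<noteq> 0" using False by simp
  ultimately show ?thesis by (simp add: reflection_along_def)
qed (simp add: reflection_along_def)

lemma reflection_along_vimage: "reflection_along w -` S = reflection_along w ` S"
proof
  show "reflection_along w -` S \<subseteq> reflection_along w ` S"
    by (metis image_eqI reflection_along_involution subsetI vimage_eq)
qed auto

lemma dist_reflection_along: "dist (reflection_along w x) (reflection_along w y) = dist x y"
  using linear_diff[OF linear_reflection_along, of w x y] by (metis dist_norm norm_reflection_along)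

lemma reflection_along_image_cball:
  "reflection_along w ` cball x r = cball (reflection_along w x) r"
proof -
  have "dist x (reflection_along w y) = dist (reflection_along w x) y" for y
    using dist_reflection_along[of w x "reflection_along w y"] by simp
  then show ?thesis
    unfolding reflection_along_vimage[symmetric] by (simp add: set_eq_iff)
qed

lemma negligible_reflection_along:
  assumes "negligible N" shows "negligible (reflection_along w ` N)"
proof (rule negligible_locally_Lipschitz_image[OF _ assms])
  fix x assume "x \<in> N"
  show "\<exists>T B. open T \<and> x \<in> T \<and>
      (\<forall>y\<in>N \<inter> T. norm (reflection_along w y - reflection_along w x) \<le> B * norm (y - x))"
    by (intro exI[of _ UNIV] exI[of _ 1]) (simp flip: dist_norm add: dist_reflection_along)
qed simp

text \<open>Up to a null set an open set is a disjoint union of balls, and balls go to balls.\<close>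

lemma emeasure_reflection_along_open:
  assumes "open U"
  shows "emeasure lebesgue (reflection_along w ` U) = emeasure lebesgue U"
proof -
  let ?T = "reflection_along w"
  define K where "K = {(x, r). 0 < r \<and> cball x r \<subseteq> U}"
  obtain C where C: "countable C" "C \<subseteq> K"
    "pairwise (\<lambda>i j. disjnt (cball (fst i) (snd i)) (cball (fst j) (snd j))) C"
    "negligible (U - (\<Union>i\<in>C. cball (fst i) (snd i)))"
  proof (rule Vitali_covering_theorem_cballs[of K snd U fst])
    show "0 < snd i" if "i \<in> K" for i using that by (auto simp: K_def)
    show "\<exists>i. i \<in> K \<and> x \<in> cball (fst i) (snd i) \<and> snd i < d" if "x \<in> U" "0 < d" for x and d :: real
    proof -
      obtain e where e: "0 < e" "cball x e \<subseteq> U"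
        using assms \<open>x \<in> U\<close> unfolding open_contains_cball by meson
      have "cball x (min e (d/2)) \<subseteq> cball x e" by (rule subset_cball) simp
      then have "cball x (min e (d/2)) \<subseteq> U" using e(2) by (rule subset_trans)
      then have "(x, min e (d/2)) \<in> K" using e(1) \<open>0 < d\<close> by (simp add: K_def)
      moreover have "x \<in> cball x (min e (d/2))" "min e (d/2) < d" using e(1) \<open>0 < d\<close> by auto
      ultimately show ?thesis by (metis fst_conv snd_conv)
    qed
  qed
  define A where "A i = cball (fst i) (snd i)" for i :: "'a \<times> real"
  have disj: "disjoint_family_on A C"
    using C(3) by (auto simp: disjoint_family_on_def pairwise_def disjnt_def A_def)
  have disjT: "disjoint_family_on (\<lambda>i. ?T ` A i) C"
    using disj by (simp add: disjoint_family_on_def flip: image_Int[OF inj_reflection_along])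
  have AU: "(\<Union>i\<in>C. A i) \<subseteq> U"
  proof (rule UN_least)
    show "A i \<subseteq> U" if "i \<in> C" for i
      using subsetD[OF C(2) that] by (simp add: K_def A_def case_prod_beta)
  qed
  have N: "U - (\<Union>i\<in>C. A i) \<in> null_sets lebesgue"
    using C(4) by (simp add: A_def negligible_iff_null_sets)
  have TN: "?T ` (U - (\<Union>i\<in>C. A i)) \<in> null_sets lebesgue"
    using C(4) negligible_reflection_along by (simp add: A_def negligible_iff_null_sets[symmetric])
  have TA: "?T ` A i = cball (?T (fst i)) (snd i)" for i
    by (simp add: A_def reflection_along_image_cball)
  have "emeasure lebesgue U = emeasure lebesgue ((\<Union>i\<in>C. A i) \<union> (U - (\<Union>i\<in>C. A i)))"
    using AU by (simp add: Un_absorb1)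
  also have "\<dots> = emeasure lebesgue (\<Union>i\<in>C. A i)"
    using N C(1) by (intro emeasure_Un_null_set) (auto simp: A_def)
  also have "\<dots> = (\<integral>\<^sup>+ i. emeasure lebesgue (A i) \<partial>count_space C)"
    by (rule emeasure_UN_countable[OF _ C(1) disj]) (simp add: A_def)
  also have "\<dots> = (\<integral>\<^sup>+ i. emeasure lebesgue (?T ` A i) \<partial>count_space C)"
  proof (rule nn_integral_cong)
    fix i assume "i \<in> space (count_space C)"
    then have "0 \<le> snd i" using C(2) by (auto simp: K_def)
    then show "emeasure lebesgue (A i) = emeasure lebesgue (?T ` A i)"
      unfolding TA by (simp add: A_def emeasure_cball)
  qed
  also have "\<dots> = emeasure lebesgue (\<Union>i\<in>C. ?T ` A i)"
    by (rule emeasure_UN_countable[OF _ C(1) disjT, symmetric]) (simp add: TA)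
  also have "\<dots> = emeasure lebesgue ((\<Union>i\<in>C. ?T ` A i) \<union> ?T ` (U - (\<Union>i\<in>C. A i)))"
    using TN C(1) by (intro emeasure_Un_null_set[symmetric]) (auto simp: TA)
  also have "(\<Union>i\<in>C. ?T ` A i) \<union> ?T ` (U - (\<Union>i\<in>C. A i)) = ?T ` U"
    using AU by (auto simp flip: image_UN image_Un simp: Un_absorb1)
  finally show ?thesis by simp
qed

lemma borel_measurable_reflection_along: "reflection_along w \<in> borel_measurable borel"
  by (intro borel_measurable_continuous_onI linear_continuous_on)
    (simp add: linear_conv_bounded_linear[symmetric] linear_reflection_along)

text \<open>Lebesgue measure is determined by its values on open boxes. The preimage of a box under
  the involution is its image, whose measure is known because the box is open.\<close>

lemma distr_reflection_along: "distr lborel borel (reflection_along w) = lborel"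
proof (rule lborel_eqI[symmetric])
  fix l u :: 'a assume "\<And>b. b \<in> Basis \<Longrightarrow> l \<bullet> b \<le> u \<bullet> b"
  have "open (reflection_along w -` box l u)"
    by (intro open_vimage continuous_on_subset[OF linear_continuous_on])
      (auto simp: linear_conv_bounded_linear[symmetric] linear_reflection_along)
  then have "emeasure (distr lborel borel (reflection_along w)) (box l u)
      = emeasure lebesgue (reflection_along w -` box l u)"
    by (simp add: emeasure_distr borel_measurable_reflection_along)
  also have "\<dots> = emeasure lborel (box l u)"
    unfolding reflection_along_vimage
    by (subst emeasure_reflection_along_open) (simp_all add: open_box)
  finally show "emeasure (distr lborel borel (reflection_along w)) (box l u)
      = ennreal (\<Prod>b\<in>Basis. (u - l) \<bullet> b)"
    using \<open>\<And>b. b \<in> Basis \<Longrightarrow> l \<bullet> b \<le> u \<bullet> b\<close> by (simp add: emeasure_lborel_box)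
qed simp

lemma measure_reflection_along:
  assumes "compact S"
  shows "measure lebesgue (reflection_along w ` S) = measure lebesgue S"
proof -
  have "compact (reflection_along w ` S)"
    by (intro compact_continuous_image linear_continuous_on assms)
      (simp add: linear_conv_bounded_linear[symmetric] linear_reflection_along)
  then have b: "S \<in> sets borel" "reflection_along w ` S \<in> sets borel"
    using assms by (auto intro: borel_compact)
  have "measure lborel S = measure (distr lborel borel (reflection_along w)) S"
    by (simp add: distr_reflection_along)
  also have "\<dots> = measure lborel (reflection_along w ` S)"
    using b by (simp add: measure_distr borel_measurable_reflection_along reflection_along_vimage)
  finally show ?thesis using b by (simp add: measure_completion)
qed

text \<open>Reflections are self-adjoint and preserve both the ball and the measure, so
  \<open>F\<close> depends on the norm only; absolute homogeneity then makes it a multiple of the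
  norm.\<close>

lemma integral_ball_abs_inner:
  fixes F :: "'a::euclidean_space \<Rightarrow> real"
  defines "F \<equiv> \<lambda>x. \<integral>u. indicator (cball 0 1) u * \<bar>x \<bullet> u\<bar> \<partial>lborel"
  shows "\<exists>c>0. \<forall>x. F x = c * norm x"
proof -
  have meas: "(\<lambda>u. indicator (cball 0 1) u * \<bar>x \<bullet> u\<bar>) \<in> borel_measurable borel" for x :: 'a
    by (intro borel_measurable_times borel_measurable_indicator borel_measurable_abs
        borel_measurable_inner) auto
  have intg: "integrable lborel (\<lambda>u. indicator (cball 0 1) u * \<bar>x \<bullet> u\<bar>)" for x :: 'a
  proof (rule Bochner_Integration.integrable_bound)
    show "integrable lborel (\<lambda>u::'a. norm x * indicator (cball 0 1) u)"
      by (intro integrable_mult_right integrable_real_indicator) (use emeasure_bounded_finite[OF bounded_cball] in simp_all)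
    show "AE u in lborel. norm (indicator (cball 0 1) u * \<bar>x \<bullet> u\<bar>)
        \<le> norm (norm x * indicator (cball 0 1) u :: real)"
    proof (rule AE_I2)
      fix u :: 'a
      show "norm (indicator (cball 0 1) u * \<bar>x \<bullet> u\<bar>) \<le> norm (norm x * indicator (cball 0 1) u :: real)"
      proof (cases "u \<in> cball 0 1")
        case True
        have "\<bar>x \<bullet> u\<bar> \<le> norm x * norm u" by (rule Cauchy_Schwarz_ineq2)
        also have "\<dots> \<le> norm x * 1" using True by (intro mult_left_mono) auto
        finally show ?thesis using True by simp
      qed simp
    qed
  qed (use meas in simp)
  have inv: "F (reflection_along w x) = F x" for w x
  proof -
    have "F x = (\<integral>u. indicator (cball 0 1) u * \<bar>x \<bullet> u\<bar> \<partial>distr lborel borel (reflection_along w))"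
      by (simp add: F_def distr_reflection_along)
    also have "\<dots> = (\<integral>u. indicator (cball 0 1) (reflection_along w u)
        * \<bar>x \<bullet> reflection_along w u\<bar> \<partial>lborel)"
      using meas[of x] borel_measurable_reflection_along by (subst integral_distr) auto
    also have "\<dots> = F (reflection_along w x)"
      unfolding F_def by (simp add: inner_reflection_along indicator_def)
    finally show ?thesis ..
  qed
  have scale: "F (s *\<^sub>R x) = \<bar>s\<bar> * F x" for s x
    unfolding F_def by (simp add: abs_mult mult.left_commute)
  obtain e :: 'a where e: "norm e = 1" using vector_choose_size[of 1] by auto
  have "F x = F e * norm x" for x
  proof -
    have "norm (norm x *\<^sub>R e) = norm x" using e by simp
    then have "F x = F (norm x *\<^sub>R e)" using inv reflection_along_diff by metis
    then show ?thesis by (simp add: scale)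
  qed
  moreover have "0 < F e"
  proof -
    \<comment> \<open>This ball lies in the unit ball, and on it the inner product with
      \<open>e\<close> is at least 1/2 - 1/4 = 1/4.\<close>
    let ?b = "cball ((1/2) *\<^sub>R e) (1/4)"
    have "0 < 1/4 * measure lborel ?b" by (simp add: content_cball_pos)
    also have "\<dots> = (\<integral>u. 1/4 * indicator ?b u \<partial>lborel)" by simp
    also have "\<dots> \<le> F e"
      unfolding F_def
    proof (rule integral_mono[OF _ intg])
      show "integrable lborel (\<lambda>u. 1/4 * indicator ?b u :: real)"
        by (intro integrable_mult_right integrable_real_indicator) (use emeasure_bounded_finite[OF bounded_cball] in simp_all)
      fix u :: 'a
      show "1/4 * indicator ?b u \<le> indicator (cball 0 1) u * \<bar>e \<bullet> u\<bar>"
      proof (cases "u \<in> ?b")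
        case True
        then have d: "norm ((1/2) *\<^sub>R e - u) \<le> 1/4" by (simp add: dist_norm)
        have "norm u \<le> norm ((1/2) *\<^sub>R e) + norm ((1/2) *\<^sub>R e - u)"
          by (metis diff_diff_eq2 norm_triangle_ineq4 add_diff_cancel_left' diff_add_cancel)
        then have u: "u \<in> cball 0 1" using d e by simp
        have "e \<bullet> ((1/2) *\<^sub>R e - u) \<le> norm e * norm ((1/2) *\<^sub>R e - u)" by (rule norm_cauchy_schwarz)
        then have "1/2 - e \<bullet> u \<le> 1/4" using d e by (simp add: inner_diff_right dot_square_norm)
        then show ?thesis using True u by simp
      qed simp
    qed
    finally show ?thesis .
  qed
  ultimately show ?thesis by blast
qed

text \<open>The integrand is Lipschitz in u with constant \<open>norm x\<close>, so a single
  partition of the ball into small cells serves all x, with an error proportional to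
  \<open>norm x\<close>.\<close>

lemma abs_inner_riemann_sum:
  fixes F :: "'a::euclidean_space \<Rightarrow> real"
  defines "F \<equiv> \<lambda>x. \<integral>u. indicator (cball 0 1) u * \<bar>x \<bullet> u\<bar> \<partial>lborel"
  assumes \<epsilon>: "0 < \<epsilon>"
  shows "\<exists>(n::nat) w. \<forall>x. \<bar>F x - (\<Sum>j<n. \<bar>x \<bullet> w j\<bar>)\<bar> \<le> \<epsilon> * norm x"
proof -
  define V where "V = measure lborel (cball (0::'a) 1)"
  have V: "0 < V" by (simp add: V_def content_cball_pos)
  \<comment> \<open>A pointwise error \<open>\<eta> * norm x\<close>, integrated over a ball of
    volume \<open>V\<close>, amounts to \<open>\<epsilon> * norm x\<close>.\<close>
  define \<eta> where "\<eta> = \<epsilon> / V"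
  have \<eta>: "0 < \<eta>" using V \<epsilon> by (simp add: \<eta>_def)
  obtain P :: "'a set" where P: "finite P" "cball 0 1 \<subseteq> (\<Union>p\<in>P. ball p \<eta>)"
    using compact_cball[of "0::'a" 1] \<eta> unfolding compact_eq_totally_bounded by meson
  obtain n and p :: "nat \<Rightarrow> 'a" where p: "P = p ` {..<n}"
    using finite_imp_nat_seg_image_inj_on[OF P(1)] by (auto simp: lessThan_def)
  define A where "A = disjointed (\<lambda>j. cball 0 1 \<inter> ball (p j) \<eta>)"
  have AE: "A j \<subseteq> cball 0 1 \<inter> ball (p j) \<eta>" for j
    unfolding A_def by (rule disjointed_subset)
  have UA: "(\<Union>j<n. A j) = cball 0 1"
  proof -
    have "(\<Union>j<n. A j) = (\<Union>j<n. cball 0 1 \<inter> ball (p j) \<eta>)"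
      unfolding A_def lessThan_atLeast0 by (rule finite_UN_disjointed_eq)
    also have "\<dots> = cball 0 1 \<inter> (\<Union>p\<in>P. ball p \<eta>)" unfolding p image_image by blast
    also have "\<dots> = cball 0 1" using P(2) by (rule Int_absorb2)
    finally show ?thesis .
  qed
  have disj: "disjoint_family_on A {..<n}"
    unfolding A_def by (rule disjoint_family_on_mono[OF subset_UNIV disjoint_family_disjointed])
  have Ab: "A j \<in> sets borel" for j
    unfolding A_def disjointed_def by auto
  have ind: "indicator (cball 0 1) u = (\<Sum>j<n. indicator (A j) u :: real)" for u
    unfolding UA[symmetric] by (rule indicator_UN_disjoint[OF _ disj]) simp
  have Afin: "emeasure lborel (A j) < \<infinity>" for j
  proof -
    have "emeasure lborel (A j) \<le> emeasure lborel (cball (0::'a) 1)"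
      using AE by (intro emeasure_mono) auto
    then show ?thesis using emeasure_bounded_finite[OF bounded_cball] by (rule le_less_trans)
  qed
  define m where "m j = measure lborel (A j)" for j
  \<comment> \<open>The volume of a cell is absorbed into the vector, since m |x . p| = |x . (m p)|
    for nonnegative m.\<close>
  define w where "w j = m j *\<^sub>R p j" for j
  have "\<bar>F x - (\<Sum>j<n. \<bar>x \<bullet> w j\<bar>)\<bar> \<le> \<epsilon> * norm x" for x
  proof -
    have diff: "\<bar>\<bar>x \<bullet> u\<bar> - \<bar>x \<bullet> p j\<bar>\<bar> \<le> \<eta> * norm x" if "u \<in> A j" for u j
    proof -
      have "\<bar>\<bar>x \<bullet> u\<bar> - \<bar>x \<bullet> p j\<bar>\<bar> \<le> \<bar>x \<bullet> (u - p j)\<bar>" by (simp add: inner_diff_right)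
      also have "\<dots> \<le> norm x * norm (u - p j)" by (rule Cauchy_Schwarz_ineq2)
      also have "\<dots> \<le> norm x * \<eta>"
        using that AE[of j] by (intro mult_left_mono) (auto simp: dist_norm norm_minus_commute)
      finally show ?thesis by (simp add: mult.commute)
    qed
    have Aint: "integrable lborel (\<lambda>u. indicator (A j) u * c :: real)" for j c
      using Ab Afin by (intro integrable_mult_left integrable_real_indicator) auto
    have fint: "integrable lborel (\<lambda>u. indicator (A j) u * \<bar>x \<bullet> u\<bar>)" for j
    proof (rule Bochner_Integration.integrable_bound[OF Aint[of j "\<eta> * norm x + \<bar>x \<bullet> p j\<bar>"]])
      show "(\<lambda>u. indicator (A j) u * \<bar>x \<bullet> u\<bar>) \<in> borel_measurable lborel"
        using Ab[of j] by (intro borel_measurable_times borel_measurable_indicator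
            borel_measurable_abs borel_measurable_inner) auto
      show "AE u in lborel. norm (indicator (A j) u * \<bar>x \<bullet> u\<bar>)
        \<le> norm (indicator (A j) u * (\<eta> * norm x + \<bar>x \<bullet> p j\<bar>))"
      proof (rule AE_I2)
        fix u
        show "norm (indicator (A j) u * \<bar>x \<bullet> u\<bar>)
          \<le> norm (indicator (A j) u * (\<eta> * norm x + \<bar>x \<bullet> p j\<bar>))"
          using diff[of u j] by (cases "u \<in> A j") auto
      qed
    qed
    have Fx: "F x = (\<integral>u. (\<Sum>j<n. indicator (A j) u * \<bar>x \<bullet> u\<bar>) \<partial>lborel)"
      unfolding F_def ind by (simp add: sum_distrib_right)
    have Sx: "(\<Sum>j<n. \<bar>x \<bullet> w j\<bar>) = (\<integral>u. (\<Sum>j<n. indicator (A j) u * \<bar>x \<bullet> p j\<bar>) \<partial>lborel)"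
      using Aint by (subst Bochner_Integration.integral_sum)
        (auto simp: w_def m_def abs_mult)
    have "F x - (\<Sum>j<n. \<bar>x \<bullet> w j\<bar>)
        = (\<integral>u. (\<Sum>j<n. indicator (A j) u * \<bar>x \<bullet> u\<bar>) - (\<Sum>j<n. indicator (A j) u * \<bar>x \<bullet> p j\<bar>) \<partial>lborel)"
      unfolding Fx Sx
      by (intro Bochner_Integration.integral_diff[symmetric] Bochner_Integration.integrable_sum fint Aint)
    also have "\<bar>\<dots>\<bar> \<le> (\<integral>u. \<bar>(\<Sum>j<n. indicator (A j) u * \<bar>x \<bullet> u\<bar>)
        - (\<Sum>j<n. indicator (A j) u * \<bar>x \<bullet> p j\<bar>)\<bar> \<partial>lborel)"
      by (rule integral_abs_bound)
    also have "\<dots> \<le> (\<integral>u. \<eta> * norm x * indicator (cball (0::'a) 1) u \<partial>lborel)"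
    proof (rule integral_mono)
      show "integrable lborel (\<lambda>u. \<bar>(\<Sum>j<n. indicator (A j) u * \<bar>x \<bullet> u\<bar>)
          - (\<Sum>j<n. indicator (A j) u * \<bar>x \<bullet> p j\<bar>)\<bar>)"
        by (intro integrable_abs Bochner_Integration.integrable_diff
            Bochner_Integration.integrable_sum fint Aint)
      show "integrable lborel (\<lambda>u::'a. \<eta> * norm x * indicator (cball 0 1) u)"
        by (intro integrable_mult_right integrable_real_indicator) (use emeasure_bounded_finite[OF bounded_cball] in simp_all)
      fix u :: 'a
      have "\<bar>(\<Sum>j<n. indicator (A j) u * \<bar>x \<bullet> u\<bar>) - (\<Sum>j<n. indicator (A j) u * \<bar>x \<bullet> p j\<bar>)\<bar>
          = \<bar>\<Sum>j<n. indicator (A j) u * (\<bar>x \<bullet> u\<bar> - \<bar>x \<bullet> p j\<bar>)\<bar>"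
        by (simp add: sum_subtractf right_diff_distrib)
      also have "\<dots> \<le> (\<Sum>j<n. \<bar>indicator (A j) u * (\<bar>x \<bullet> u\<bar> - \<bar>x \<bullet> p j\<bar>)\<bar>)" by (rule sum_abs)
      also have "\<dots> \<le> (\<Sum>j<n. indicator (A j) u * (\<eta> * norm x))"
      proof (rule sum_mono)
        fix j
        show "\<bar>indicator (A j) u * (\<bar>x \<bullet> u\<bar> - \<bar>x \<bullet> p j\<bar>)\<bar> \<le> indicator (A j) u * (\<eta> * norm x)"
          using diff[of u j] by (cases "u \<in> A j") auto
      qed
      also have "\<dots> = \<eta> * norm x * indicator (cball 0 1) u"
        unfolding ind sum_distrib_right[symmetric] by (rule mult.commute)
      finally show "\<bar>(\<Sum>j<n. indicator (A j) u * \<bar>x \<bullet> u\<bar>) - (\<Sum>j<n. indicator (A j) u * \<bar>x \<bullet> p j\<bar>)\<bar>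
          \<le> \<eta> * norm x * indicator (cball 0 1) u" .
    qed
    also have "\<dots> = \<epsilon> * norm x" using V by (simp add: \<eta>_def V_def)
    finally show ?thesis .
  qed
  then show ?thesis by blast
qed

lemma norm_approx_sum_abs_inner:
  assumes \<epsilon>: "0 < \<epsilon>"
  shows "\<exists>(n::nat) w. \<forall>x::'a::euclidean_space. norm x \<le> (\<Sum>j<n. \<bar>x \<bullet> w j\<bar>) \<and>
    (\<Sum>j<n. \<bar>x \<bullet> w j\<bar>) \<le> (1 + \<epsilon>) * norm x"
proof -
  obtain c where c: "0 < c"
    "\<And>x::'a. (\<integral>u. indicator (cball 0 1) u * \<bar>x \<bullet> u\<bar> \<partial>lborel) = c * norm x"
    using integral_ball_abs_inner by blast
  \<comment> \<open>Solves (c + \<delta>) / (c - \<delta>) = 1 + \<epsilon>, so that division by c -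
    \<delta> turns the two-sided error into a lower bound with constant exactly 1.\<close>
  define \<delta> where "\<delta> = c * \<epsilon> / (2 + \<epsilon>)"
  have \<delta>: "0 < \<delta>" "\<delta> < c" using c \<epsilon> by (auto simp: \<delta>_def field_simps)
  have \<delta>eq: "c + \<delta> = (1 + \<epsilon>) * (c - \<delta>)" using \<epsilon> by (simp add: \<delta>_def field_simps)
  obtain n :: nat and w :: "nat \<Rightarrow> 'a"
    where w: "\<And>x. \<bar>c * norm x - (\<Sum>j<n. \<bar>x \<bullet> w j\<bar>)\<bar> \<le> \<delta> * norm x"
    using abs_inner_riemann_sum[OF \<delta>(1), where 'a='a] unfolding c(2) by blast
  let ?w = "\<lambda>j. w j /\<^sub>R (c - \<delta>)"
  have "norm x \<le> (\<Sum>j<n. \<bar>x \<bullet> ?w j\<bar>) \<and> (\<Sum>j<n. \<bar>x \<bullet> ?w j\<bar>) \<le> (1 + \<epsilon>) * norm x" for x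
  proof -
    have eq: "(\<Sum>j<n. \<bar>x \<bullet> ?w j\<bar>) = (\<Sum>j<n. \<bar>x \<bullet> w j\<bar>) / (c - \<delta>)"
      using \<delta> by (simp add: abs_mult sum_distrib_left divide_inverse mult.commute)
    have "(c - \<delta>) * norm x \<le> (\<Sum>j<n. \<bar>x \<bullet> w j\<bar>)" "(\<Sum>j<n. \<bar>x \<bullet> w j\<bar>) \<le> (c + \<delta>) * norm x"
      using w[of x] by (auto simp: abs_le_iff algebra_simps)
    then show ?thesis
      using \<delta> unfolding eq \<delta>eq by (simp add: field_simps)
  qed
  then show ?thesis by (intro exI[of _ n] exI[of _ ?w]) blast
qed

subsection \<open>The Steiner polynomial\<close>

lemma measure_scaleR_image:
  "measure lebesgue ((*\<^sub>R) c ` (S :: 'a::euclidean_space set)) = \<bar>c\<bar> ^ DIM('a) * measure lebesgue S"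
  using measure_lebesgue_affine[of c 0 S] by simp

lemma measure_cball_scale:
  assumes "0 \<le> t"
  shows "measure lebesgue (cball (c::'a::euclidean_space) t)
    = measure lebesgue (cball (0::'a) 1) * t ^ DIM('a)"
  using assms by (simp add: content_cball)

lemma cball_plus_cball:
  assumes "0 \<le> s" "0 \<le> t"
  shows "cball 0 s + cball 0 t = cball (0::'a::euclidean_space) (s + t)"
proof
  show "cball 0 s + cball 0 t \<subseteq> cball (0::'a) (s + t)"
    by (auto simp: set_plus_def) (meson add_mono norm_triangle_le)
  show "cball (0::'a) (s + t) \<subseteq> cball 0 s + cball 0 t"
  proof
    fix x :: 'a assume x: "x \<in> cball 0 (s + t)"
    show "x \<in> cball 0 s + cball 0 t"
    proof (cases "s + t = 0")
      case True
      then have "x = 0 + 0" "s = 0" "t = 0" using x assms by auto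
      then show ?thesis by simp
    next
      case False
      then have p: "0 < s + t" using assms by simp
      have "(s / (s + t)) *\<^sub>R x + (t / (s + t)) *\<^sub>R x = x"
        using False by (simp flip: scaleR_add_left add_divide_distrib)
      moreover have "norm ((s / (s + t)) *\<^sub>R x) \<le> s" "norm ((t / (s + t)) *\<^sub>R x) \<le> t"
        using x p assms mult_left_mono[of "norm x" "s + t" s] mult_left_mono[of "norm x" "s + t" t]
        by (auto simp: field_simps)
      ultimately show ?thesis
        unfolding set_plus_def by (intro CollectI bexI[of _ "(s / (s + t)) *\<^sub>R x"] bexI[of _ "(t / (s + t)) *\<^sub>R x"]) auto
    qed
  qed
qed

lemma polynomial_growth_coeff_zero:
  fixes c :: "nat \<Rightarrow> real"
  assumes nonneg: "\<And>i. 0 \<le> c i"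
    and bound: "\<And>t. 0 \<le> t \<Longrightarrow> (\<Sum>i\<le>m. c i * t ^ i) \<le> C * (1 + t) ^ N"
    and i: "i \<le> m" "N < i"
  shows "c i = 0"
proof (rule ccontr)
  assume "c i \<noteq> 0"
  then have ci: "0 < c i" using nonneg[of i] by simp
  have C: "0 \<le> C"
  proof -
    have "0 \<le> (\<Sum>i\<le>m. c i * 0 ^ i)" by (intro sum_nonneg mult_nonneg_nonneg nonneg) auto
    then show ?thesis using bound[of 0] by simp
  qed
  \<comment> \<open>Past t = 1 the right side is at most C 2^N t^N while the left is at least c_i t
    t^N; here c_i t exceeds C 2^N by c_i.\<close>
  define t where "t = C * 2 ^ N / c i + 1"
  have t: "1 \<le> t" using C ci by (simp add: t_def)
  have "c i * t * t ^ N = c i * t ^ Suc N" by simp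
  also have "\<dots> \<le> c i * t ^ i" using t i ci by (intro mult_left_mono power_increasing) auto
  also have "\<dots> \<le> (\<Sum>i\<le>m. c i * t ^ i)"
    using i nonneg t by (intro member_le_sum) auto
  also have "\<dots> \<le> C * (1 + t) ^ N" using t by (intro bound) simp
  also have "\<dots> \<le> C * (2 * t) ^ N" using t C by (intro mult_left_mono power_mono) auto
  also have "\<dots> = C * 2 ^ N * t ^ N" by (simp add: power_mult_distrib)
  finally have "c i * t \<le> C * 2 ^ N" using t by simp
  moreover have "c i * t = C * 2 ^ N + c i" using ci by (simp add: t_def field_simps)
  ultimately show False using ci by simp
qed

text \<open>A zonotope between the unit ball and its (1 + \<epsilon>)-multiple gives a polynomial
  with nonnegative coefficients between the two parallel volumes. Its degree is at most the number
  of segments, which grows as \<epsilon> shrinks, but the volume is O((1 + t)^N), so all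
  coefficients above the dimension N vanish. The uniform degree is what permits a limit of
  coefficients.\<close>

lemma parallel_volume_zonotope_sandwich:
  fixes K :: "'a::euclidean_space set"
  assumes K: "compact_convex K" and \<epsilon>: "0 < \<epsilon>"
  shows "\<exists>c. (\<forall>i. 0 \<le> c i) \<and> (\<forall>t\<ge>0.
    measure lebesgue (K + cball 0 t) \<le> (\<Sum>i\<le>DIM('a). c i * t ^ i) \<and>
    (\<Sum>i\<le>DIM('a). c i * t ^ i) \<le> measure lebesgue (K + cball 0 ((1 + \<epsilon>) * t)))"
proof -
  obtain n :: nat and w :: "nat \<Rightarrow> 'a" where w: "\<And>x. norm x \<le> (\<Sum>j<n. \<bar>x \<bullet> w j\<bar>)"
    "\<And>x. (\<Sum>j<n. \<bar>x \<bullet> w j\<bar>) \<le> (1 + \<epsilon>) * norm x"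
    using norm_approx_sum_abs_inner[OF \<epsilon>] by blast
  define Z where "Z t = (\<Sum>j<n. segm (t *\<^sub>R w j))" for t
  have Z: "cball 0 t \<subseteq> Z t" "Z t \<subseteq> cball 0 ((1 + \<epsilon>) * t)" if t: "0 \<le> t" for t
  proof -
    have eq: "(\<Sum>j<n. \<bar>x \<bullet> (t *\<^sub>R w j)\<bar>) = t * (\<Sum>j<n. \<bar>x \<bullet> w j\<bar>)" for x
      using t by (simp add: abs_mult sum_distrib_left)
    have "t * norm x \<le> (\<Sum>j<n. \<bar>x \<bullet> (t *\<^sub>R w j)\<bar>)"
      "(\<Sum>j<n. \<bar>x \<bullet> (t *\<^sub>R w j)\<bar>) \<le> ((1 + \<epsilon>) * t) * norm x" for x
      unfolding eq using mult_left_mono[OF w(1)[of x] t] mult_left_mono[OF w(2)[of x] t]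
      by (simp_all add: ac_simps)
    then show "cball 0 t \<subseteq> Z t" "Z t \<subseteq> cball 0 ((1 + \<epsilon>) * t)"
      unfolding Z_def using zonotope_between_balls[of "{..<n}" t "\<lambda>j. t *\<^sub>R w j" "(1 + \<epsilon>) * t"] t \<epsilon>
      by simp_all
  qed
  have ccZ: "compact_convex (K + Z t)" for t
    unfolding Z_def by (intro compact_convex_plus K compact_convex_sum_segm)
  have ccB: "compact_convex (K + cball 0 t)" if "0 \<le> t" for t
    using that by (intro compact_convex_plus K compact_convex_cball)
  obtain d where d: "\<And>i. polyaffine (d i)" "\<And>t. 0 \<le> t \<Longrightarrow> measure lebesgue (K + Z t) = (\<Sum>i\<le>n. d i K * t ^ i)"
    using polyaffine_zonotope_polynomial[OF finite_lessThan[of n] polyaffine_measure, of w] K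
    unfolding Z_def by auto
  have lo: "measure lebesgue (K + cball 0 t) \<le> measure lebesgue (K + Z t)" if "0 \<le> t" for t
    using that by (intro measure_mono_compact_convex ccB ccZ set_plus_mono2 Z) auto
  have hi: "measure lebesgue (K + Z t) \<le> measure lebesgue (K + cball 0 ((1 + \<epsilon>) * t))" if "0 \<le> t" for t
    using that \<epsilon> by (intro measure_mono_compact_convex ccB ccZ set_plus_mono2 Z) auto
  have d0: "0 \<le> d i K" for i using d(1)[of i] K by (simp add: polyaffine_def)
  obtain R where R: "0 \<le> R" "K \<subseteq> cball 0 R"
  proof -
    have "bounded K" using K by (simp add: compact_convex_def compact_imp_bounded)
    then obtain R where "0 < R" "\<forall>x\<in>K. norm x \<le> R" using bounded_pos by blast
    then show ?thesis by (intro that[of R]) auto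
  qed
  define \<omega> where "\<omega> = measure lebesgue (cball (0::'a) 1)"
  have cut: "d i K = 0" if i: "i \<le> n" "DIM('a) < i" for i
  proof (rule polynomial_growth_coeff_zero[where c="\<lambda>i. d i K", OF d0 _ i])
    fix t :: real assume t: "0 \<le> t"
    have "(\<Sum>i\<le>n. d i K * t ^ i) \<le> measure lebesgue (K + cball 0 ((1 + \<epsilon>) * t))"
      using hi[OF t] d(2)[OF t] by simp
    also have "\<dots> \<le> measure lebesgue (cball 0 R + cball (0::'a) ((1 + \<epsilon>) * t))"
      using t \<epsilon> R by (intro measure_mono_compact_convex ccB set_plus_mono2 compact_convex_plus compact_convex_cball) auto
    also have "\<dots> = measure lebesgue (cball (0::'a) (R + (1 + \<epsilon>) * t))"
      using t \<epsilon> R by (simp add: cball_plus_cball)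
    also have "\<dots> \<le> measure lebesgue (cball (0::'a) ((R + 1 + \<epsilon>) * (1 + t)))"
      using t \<epsilon> R by (intro measure_mono_compact_convex compact_convex_cball subset_cball)
        (auto simp: algebra_simps)
    also have "\<dots> = \<omega> * ((R + 1 + \<epsilon>) * (1 + t)) ^ DIM('a)"
      unfolding \<omega>_def using t \<epsilon> R by (intro measure_cball_scale) auto
    also have "\<dots> = (\<omega> * (R + 1 + \<epsilon>) ^ DIM('a)) * (1 + t) ^ DIM('a)"
      by (simp add: power_mult_distrib)
    finally show "(\<Sum>i\<le>n. d i K * t ^ i) \<le> (\<omega> * (R + 1 + \<epsilon>) ^ DIM('a)) * (1 + t) ^ DIM('a)" .
  qed
  define c where "c i = (if i \<le> n then d i K else 0)" for i
  have ceq: "(\<Sum>i\<le>DIM('a). c i * t ^ i) = (\<Sum>i\<le>n. d i K * t ^ i)" for t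
  proof -
    have "(\<Sum>i\<le>DIM('a). c i * t ^ i) = (\<Sum>i\<in>{..DIM('a)} \<inter> {..n}. c i * t ^ i)"
      by (intro sum.mono_neutral_right) (auto simp: c_def)
    also have "\<dots> = (\<Sum>i\<le>n. c i * t ^ i)"
      by (intro sum.mono_neutral_left) (auto simp: c_def cut not_le)
    finally show ?thesis by (simp add: c_def)
  qed
  show ?thesis
    using lo hi d(2) d0 by (intro exI[of _ c]) (auto simp: ceq, simp add: c_def)
qed

text \<open>Bolzano-Weierstrass one coordinate at a time; with finitely many coordinates, repeated
  refinement of the subsequence is enough.\<close>

lemma coeffs_convergent_subseq:
  fixes x :: "nat \<Rightarrow> nat \<Rightarrow> real"
  assumes "\<And>n i. i < m \<Longrightarrow> x n i \<in> {0..M}"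
  shows "\<exists>r l. strict_mono (r :: nat \<Rightarrow> nat) \<and> (\<forall>i<m. (\<lambda>n. x (r n) i) \<longlonglongrightarrow> l i)"
  using assms
proof (induction m)
  case 0
  show ?case by (intro exI[of _ "\<lambda>a. a"]) (simp add: strict_mono_def)
next
  case (Suc m)
  then obtain r l where r: "strict_mono (r :: nat \<Rightarrow> nat)" "\<And>i. i < m \<Longrightarrow> (\<lambda>n. x (r n) i) \<longlonglongrightarrow> l i"
    by (meson less_SucI)
  have "\<forall>n. x (r n) m \<in> {0..M}" using Suc.prems[of m] by blast
  then have "\<exists>b\<in>{0..M}. \<exists>s. strict_mono s \<and> ((\<lambda>n. x (r n) m) \<circ> s) \<longlonglongrightarrow> b"
    using compact_Icc[of 0 M] unfolding compact_def by meson
  then obtain b s where s: "strict_mono (s :: nat \<Rightarrow> nat)" "(\<lambda>n. x (r (s n)) m) \<longlonglongrightarrow> b"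
    by (auto simp: o_def)
  have "(\<lambda>n. x ((r \<circ> s) n) i) \<longlonglongrightarrow> (l(m := b)) i" if "i < Suc m" for i
    using s(2) LIMSEQ_subseq_LIMSEQ[OF r(2) s(1)] that by (cases "i = m") (auto simp: o_def)
  then show ?case using strict_mono_o[OF r(1) s(1)] by blast
qed

text \<open>The sandwiching polynomials have bounded coefficients, so a subsequence of them
  converges coefficientwise. That the limit is the parallel volume needs v((1 + \<epsilon>) t) to
  tend to v(t), which dilation gives once the origin lies in the body.\<close>

theorem steiner_polynomial:
  fixes K :: "'a::euclidean_space set"
  assumes K: "compact_convex K"
  shows "\<exists>q. (\<forall>i. i \<le> DIM('a) \<longrightarrow> 0 \<le> q i) \<and>
    (\<forall>t\<ge>0. measure lebesgue (K + cball 0 t) = (\<Sum>i\<le>DIM('a). q i * t ^ i))"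
proof -
  obtain k where k: "k \<in> K" using K by (auto simp: compact_convex_def)
  \<comment> \<open>With 0 in \<open>L\<close>, convexity puts \<open>L\<close> inside (1 +
    \<epsilon>) L, so the parallel body at distance (1 + \<epsilon>) t lies in the (1 +
    \<epsilon>)-multiple of the one at distance t.\<close>
  define L where "L = K + {-k}"
  have L: "compact_convex L" unfolding L_def by (intro compact_convex_plus K compact_convex_singleton)
  have L0: "0 \<in> L" using k by (force simp: L_def set_plus_def)
  have vol: "measure lebesgue (L + cball 0 t) = measure lebesgue (K + cball 0 t)" for t
  proof -
    have "L + cball 0 t = (K + cball 0 t) + {-k}" by (simp add: L_def ac_simps)
    then show ?thesis by (simp only: measure_translation_singleton)
  qed
  define v where "v t = measure lebesgue (L + cball 0 t)" for t
  have ccB: "compact_convex (L + cball 0 t)" if "0 \<le> t" for t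
    using that by (intro compact_convex_plus L compact_convex_cball)
  have vs: "v ((1 + \<epsilon>) * t) \<le> (1 + \<epsilon>) ^ DIM('a) * v t" if "0 < \<epsilon>" "0 \<le> t" for \<epsilon> t
  proof -
    have "L + cball 0 ((1 + \<epsilon>) * t) \<subseteq> (*\<^sub>R) (1 + \<epsilon>) ` (L + cball 0 t)"
    proof
      fix z assume "z \<in> L + cball 0 ((1 + \<epsilon>) * t)"
      then obtain a b where ab: "z = a + b" "a \<in> L" "norm b \<le> (1 + \<epsilon>) * t"
        by (auto simp: set_plus_def)
      have "(1 / (1 + \<epsilon>)) *\<^sub>R a + (1 - 1 / (1 + \<epsilon>)) *\<^sub>R 0 \<in> L"
        using L L0 ab(2) that unfolding compact_convex_def by (intro convexD) auto
      then have a: "a /\<^sub>R (1 + \<epsilon>) \<in> L" by (simp add: divide_inverse)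
      have b: "b /\<^sub>R (1 + \<epsilon>) \<in> cball 0 t" using ab(3) that by (simp add: field_simps)
      have "z = (1 + \<epsilon>) *\<^sub>R (a /\<^sub>R (1 + \<epsilon>) + b /\<^sub>R (1 + \<epsilon>))"
        using that ab(1) by (simp add: scaleR_add_right)
      then show "z \<in> (*\<^sub>R) (1 + \<epsilon>) ` (L + cball 0 t)" using set_plus_intro[OF a b] by blast
    qed
    moreover have "compact ((*\<^sub>R) (1 + \<epsilon>) ` (L + cball 0 t))"
      using ccB[OF that(2)] unfolding compact_convex_def by (auto intro: compact_scaling)
    moreover have "compact (L + cball 0 ((1 + \<epsilon>) * t))"
      using ccB[of "(1 + \<epsilon>) * t"] that unfolding compact_convex_def by auto
    ultimately have "v ((1 + \<epsilon>) * t) \<le> measure lebesgue ((*\<^sub>R) (1 + \<epsilon>) ` (L + cball 0 t))"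
      unfolding v_def by (intro measure_mono_fmeasurable lmeasurable_compact fmeasurableD) auto
    then show ?thesis using that by (simp add: measure_scaleR_image v_def)
  qed
  have "\<forall>n. \<exists>c. (\<forall>i. 0 \<le> c i) \<and> (\<forall>t\<ge>0. v t \<le> (\<Sum>i\<le>DIM('a). c i * t ^ i) \<and>
      (\<Sum>i\<le>DIM('a). c i * t ^ i) \<le> v ((1 + 1 / real (Suc n)) * t))"
    unfolding v_def by (intro allI parallel_volume_zonotope_sandwich L) simp
  then obtain c :: "nat \<Rightarrow> nat \<Rightarrow> real" where c: "\<And>n i. 0 \<le> c n i"
    "\<And>n t. 0 \<le> t \<Longrightarrow> v t \<le> (\<Sum>i\<le>DIM('a). c n i * t ^ i)"
    "\<And>n t. 0 \<le> t \<Longrightarrow> (\<Sum>i\<le>DIM('a). c n i * t ^ i) \<le> v ((1 + 1 / real (Suc n)) * t)"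
    by metis
  have c': "(\<Sum>i\<le>DIM('a). c n i * t ^ i) \<le> (1 + 1 / real (Suc n)) ^ DIM('a) * v t" if "0 \<le> t" for n t
    using c(3)[OF that, of n] vs[of "1 / real (Suc n)" t] that by simp
  have v0: "0 \<le> v t" for t by (simp add: v_def)
  \<comment> \<open>At t = 1 the polynomial is the sum of its coefficients, and each nonnegative
    coefficient is at most that sum.\<close>
  have bnd: "c n i \<in> {0..2 ^ DIM('a) * v 1}" if "i < Suc DIM('a)" for n i
  proof -
    have "c n i \<le> (\<Sum>i\<le>DIM('a). c n i)" using that c(1) by (intro member_le_sum) auto
    also have "\<dots> \<le> (1 + 1 / real (Suc n)) ^ DIM('a) * v 1" using c'[of 1 n] by simp
    also have "\<dots> \<le> 2 ^ DIM('a) * v 1" by (intro mult_right_mono power_mono v0) (auto simp: field_simps)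
    finally show ?thesis using c(1) by simp
  qed
  obtain r q where r: "strict_mono (r :: nat \<Rightarrow> nat)"
    "\<And>i. i \<le> DIM('a) \<Longrightarrow> (\<lambda>n. c (r n) i) \<longlonglongrightarrow> q i"
    using coeffs_convergent_subseq[of "Suc DIM('a)" c, OF bnd] by (auto simp: less_Suc_eq_le)
  have q0: "0 \<le> q i" if "i \<le> DIM('a)" for i
    by (rule LIMSEQ_le_const[OF r(2)[OF that]]) (simp add: c(1))
  have "v t = (\<Sum>i\<le>DIM('a). q i * t ^ i)" if t: "0 \<le> t" for t
  proof -
    have 1: "(\<lambda>n. \<Sum>i\<le>DIM('a). c (r n) i * t ^ i) \<longlonglongrightarrow> (\<Sum>i\<le>DIM('a). q i * t ^ i)"
      by (intro tendsto_sum tendsto_mult_right r(2)) auto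
    have "(\<lambda>n. (1 + 1 / real (Suc n)) ^ DIM('a) * v t) \<longlonglongrightarrow> (1 + 0) ^ DIM('a) * v t"
      by (intro tendsto_intros LIMSEQ_Suc[OF lim_1_over_n])
    then have up: "(\<lambda>n. (1 + 1 / real (Suc (r n))) ^ DIM('a) * v t) \<longlonglongrightarrow> v t"
      using LIMSEQ_subseq_LIMSEQ[OF _ r(1)] by (fastforce simp: o_def)
    have 2: "(\<lambda>n. \<Sum>i\<le>DIM('a). c (r n) i * t ^ i) \<longlonglongrightarrow> v t"
      by (rule tendsto_sandwich[OF _ _ tendsto_const up]) (auto intro!: always_eventually c(2) c'[OF t] t simp del: of_nat_Suc)
    show ?thesis using LIMSEQ_unique[OF 2 1] .
  qed
  then show ?thesis using q0 by (intro exI[of _ q]) (auto simp: v_def vol)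
qed

lemma polynomial_coeffs_unique:
  fixes c d :: "nat \<Rightarrow> real"
  assumes "\<And>t. 0 \<le> t \<Longrightarrow> (\<Sum>i\<le>n. c i * t ^ i) = (\<Sum>i\<le>n. d i * t ^ i)" and "i \<le> n"
  shows "c i = d i"
proof (rule ccontr)
  assume "c i \<noteq> d i"
  then have "finite {t. (\<Sum>i\<le>n. (c i - d i) * t ^ i) = 0}"
    using assms(2) Poly_Roots.polyfun_rootbound[of n "\<lambda>i. c i - d i"] by auto
  moreover have "{0..} \<subseteq> {t. (\<Sum>i\<le>n. (c i - d i) * t ^ i) = 0}"
    using assms(1) by (auto simp: left_diff_distrib sum_subtractf)
  ultimately have "finite {0::real..}" using finite_subset by blast
  then show False using infinite_Ici by blast
qed

lemma parallel_body_eq: "parallel_body K t = K + cball 0 t"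
  unfolding parallel_body_def set_plus_def by blast

lemma quermass_eqI:
  fixes K :: "'a::euclidean_space set"
  assumes q: "\<And>t. 0 \<le> t \<Longrightarrow> measure lebesgue (K + cball 0 t) = (\<Sum>i\<le>DIM('a). q i * t ^ i)"
    and "i \<le> DIM('a)"
  shows "quermass K i = q i / real (DIM('a) choose i)"
proof -
  define w where "w i = (if i \<le> DIM('a) then q i / real (DIM('a) choose i) else 0)" for i
  have "quermass K = w"
    unfolding quermass_def
  proof (rule the_equality)
    show "(\<forall>i>DIM('a). w i = 0) \<and> (\<forall>t\<ge>0. measure lebesgue (parallel_body K t) =
        (\<Sum>i\<le>DIM('a). real (DIM('a) choose i) * w i * t ^ i))"
      by (auto simp: w_def parallel_body_eq q intro!: sum.cong)
    fix u assume u: "(\<forall>i>DIM('a). u i = 0) \<and> (\<forall>t\<ge>0. measure lebesgue (parallel_body K t) =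
        (\<Sum>i\<le>DIM('a). real (DIM('a) choose i) * u i * t ^ i))"
    have "real (DIM('a) choose i) * u i = q i" if "i \<le> DIM('a)" for i
      by (rule polynomial_coeffs_unique[where c = "\<lambda>i. real (DIM('a) choose i) * u i", OF _ that])
        (use u q in \<open>simp add: parallel_body_eq\<close>)
    then have "u i = w i" for i
      using u by (cases "i \<le> DIM('a)") (auto simp: w_def field_simps)
    then show "u = w" by blast
  qed
  then show ?thesis using assms(2) by (simp add: w_def)
qed

subsection \<open>Segments and triangles\<close>

text \<open>Since \<open>segm w\<close> has length 2 |w|, this is 2 |w| times the volume of the
  (N-1)-dimensional unit ball. Only its positivity and proportionality to |w| are used.\<close>

definition segm_coeff :: "'a::euclidean_space \<Rightarrow> real" where
  "segm_coeff w = dirdiff w (measure lebesgue) (cball 0 1)"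

lemma linear_image_plus:
  assumes "linear f" shows "f ` (A + B) = f ` A + f ` B"
proof
  show "f ` (A + B) \<subseteq> f ` A + f ` B"
    by (auto simp: linear_add[OF assms] elim!: set_plus_elim intro!: set_plus_intro)
  show "f ` A + f ` B \<subseteq> f ` (A + B)"
  proof
    fix z assume "z \<in> f ` A + f ` B"
    then obtain a b where "a \<in> A" "b \<in> B" "z = f (a + b)"
      by (auto simp: set_plus_def linear_add[OF assms])
    then show "z \<in> f ` (A + B)" by blast
  qed
qed

lemma linear_image_segm: "linear f \<Longrightarrow> f ` segm w = segm (f w)"
  by (simp add: segm_def image_image linear_scale)

lemma segm_uminus: "segm (- w) = segm w"
proof -
  have "segm (- w) = (\<lambda>t. t *\<^sub>R w) ` uminus ` {-1..1}"
    unfolding segm_def image_image by simp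
  then show ?thesis by (simp add: segm_def)
qed

lemma scaleR_image_cball: "0 < t \<Longrightarrow> (*\<^sub>R) t ` cball (0::'a::euclidean_space) 1 = cball 0 t"
  using cball_scale[of t "0::'a" 1] by simp

lemma measure_unit_ball_plus_segm:
  fixes w :: "'a::euclidean_space"
  shows "0 \<le> s \<Longrightarrow> measure lebesgue (cball 0 1 + segm (s *\<^sub>R w))
    = measure lebesgue (cball (0::'a) 1) + s * segm_coeff w"
  unfolding segm_coeff_def
  by (intro polyaffine_dirdiff polyaffine_measure compact_convex_cball) simp_all

text \<open>Rescaling to the unit ball divides the segment by t, and the affine dependence on 1/t
  becomes the two top powers of t.\<close>

lemma measure_cball_plus_segm:
  fixes w :: "'a::euclidean_space"
  assumes "0 < t"
  shows "measure lebesgue (cball 0 t + segm w)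
    = measure lebesgue (cball (0::'a) 1) * t ^ DIM('a) + segm_coeff w * t ^ (DIM('a) - 1)"
proof -
  have "(*\<^sub>R) t ` (cball 0 1 + segm ((1/t) *\<^sub>R w)) = cball 0 t + segm w"
    using assms by (simp add: linear_image_plus linear_scale_self linear_image_segm scaleR_image_cball)
  then have "measure lebesgue (cball 0 t + segm w)
      = t ^ DIM('a) * measure lebesgue (cball 0 1 + segm ((1/t) *\<^sub>R w))"
    using assms by (metis measure_scaleR_image abs_of_pos)
  also have "\<dots> = t ^ DIM('a) * (measure lebesgue (cball (0::'a) 1) + (1/t) * segm_coeff w)"
    using assms by (simp add: measure_unit_ball_plus_segm)
  also have "\<dots> = measure lebesgue (cball (0::'a) 1) * t ^ DIM('a) + segm_coeff w * t ^ (DIM('a) - 1)"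
  proof -
    have "t ^ DIM('a) = t * t ^ (DIM('a) - 1)" by (simp flip: power_Suc)
    then show ?thesis using assms by (simp add: field_simps)
  qed
  finally show ?thesis .
qed

text \<open>The term dropped is the mixed second difference of the volume at the ball, which is
  nonnegative because differences of polyaffine functionals are polyaffine.\<close>

lemma measure_cball_plus_two_segm_ge:
  fixes v w :: "'a::euclidean_space"
  assumes "0 < t"
  shows "measure lebesgue (cball (0::'a) 1) * t ^ DIM('a)
      + (segm_coeff v + segm_coeff w) * t ^ (DIM('a) - 1)
    \<le> measure lebesgue (cball 0 t + segm v + segm w)"
proof -
  let ?B = "cball (0::'a) 1" and ?s = "1 / t"
  have cc: "compact_convex ?B" by (simp add: compact_convex_cball)
  have s: "0 \<le> ?s" using assms by simp
  have p1: "polyaffine (dirdiff w (measure lebesgue))"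
    by (intro polyaffine_polyaffine_dirdiff polyaffine_measure)
  have d: "0 \<le> dirdiff v (dirdiff w (measure lebesgue)) ?B"
    using polyaffine_polyaffine_dirdiff[OF p1, of v] cc by (simp add: polyaffine_def)
  have "(*\<^sub>R) t ` (?B + segm (?s *\<^sub>R v) + segm (?s *\<^sub>R w)) = cball 0 t + segm v + segm w"
    using assms by (simp add: linear_image_plus linear_scale_self linear_image_segm scaleR_image_cball)
  then have "measure lebesgue (cball 0 t + segm v + segm w)
      = t ^ DIM('a) * measure lebesgue (?B + segm (?s *\<^sub>R v) + segm (?s *\<^sub>R w))"
    using assms by (metis measure_scaleR_image abs_of_pos)
  also have "measure lebesgue (?B + segm (?s *\<^sub>R v) + segm (?s *\<^sub>R w))
      = measure lebesgue (?B + segm (?s *\<^sub>R v))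
        + ?s * dirdiff w (measure lebesgue) (?B + segm (?s *\<^sub>R v))"
    using s by (intro polyaffine_dirdiff polyaffine_measure compact_convex_plus cc compact_convex_segm)
  also have "dirdiff w (measure lebesgue) (?B + segm (?s *\<^sub>R v))
      = segm_coeff w + ?s * dirdiff v (dirdiff w (measure lebesgue)) ?B"
    unfolding segm_coeff_def by (rule polyaffine_dirdiff[OF p1 cc s])
  also have "measure lebesgue (?B + segm (?s *\<^sub>R v)) = measure lebesgue ?B + ?s * segm_coeff v"
    by (rule measure_unit_ball_plus_segm[OF s])
  finally have eq: "measure lebesgue (cball 0 t + segm v + segm w) = t ^ DIM('a) *
      (measure lebesgue ?B + ?s * segm_coeff v
        + ?s * (segm_coeff w + ?s * dirdiff v (dirdiff w (measure lebesgue)) ?B))" .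
  have "measure lebesgue ?B * t ^ DIM('a) + (segm_coeff v + segm_coeff w) * t ^ (DIM('a) - 1)
      = t ^ DIM('a) * (measure lebesgue ?B + ?s * segm_coeff v + ?s * segm_coeff w)"
  proof -
    have "t ^ DIM('a) = t * t ^ (DIM('a) - 1)" by (simp flip: power_Suc)
    then show ?thesis using assms by (simp add: field_simps)
  qed
  also have "\<dots> \<le> measure lebesgue (cball 0 t + segm v + segm w)"
    unfolding eq using d s assms by (intro mult_left_mono add_left_mono) (auto simp: mult_left_mono)
  finally show ?thesis .
qed

lemma segm_coeff_scaleR: "0 \<le> s \<Longrightarrow> segm_coeff (s *\<^sub>R w) = s * segm_coeff w"
  using measure_unit_ball_plus_segm[of s w] measure_unit_ball_plus_segm[of 1 "s *\<^sub>R w"] by simp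

lemma segm_coeff_reflection: "segm_coeff (reflection_along u w) = segm_coeff w"
proof -
  have "reflection_along u ` (cball 0 1 + segm w) = cball 0 1 + segm (reflection_along u w)"
    using linear_0[OF linear_reflection_along, of u]
    by (simp add: linear_image_plus linear_reflection_along linear_image_segm reflection_along_image_cball)
  moreover have "compact (cball 0 1 + segm w)"
    using compact_convex_plus[OF compact_convex_cball[of 1 0] compact_convex_segm[of w]]
    by (simp add: compact_convex_def)
  ultimately show ?thesis
    using measure_reflection_along[of "cball 0 1 + segm w" u] by (simp add: segm_coeff_def dirdiff_def)
qed

lemma segm_coeff_eq_norm:
  "\<exists>\<kappa>>0. \<forall>w::'a::euclidean_space. segm_coeff w = \<kappa> * norm w"
proof -
  obtain e :: 'a where e: "norm e = 1" using vector_choose_size[of 1] by auto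
  have "segm_coeff w = segm_coeff e * norm w" for w :: 'a
  proof -
    have "norm (norm w *\<^sub>R e) = norm w" using e by simp
    then have "segm_coeff w = segm_coeff (norm w *\<^sub>R e)"
      using segm_coeff_reflection reflection_along_diff by metis
    then show ?thesis by (simp add: segm_coeff_scaleR)
  qed
  moreover have "0 < segm_coeff e"
  proof -
    let ?\<omega> = "measure lebesgue (cball (0::'a) 1)"
    \<comment> \<open>The ball swept along the segment from -2e to 2e contains two disjoint unit
      balls, so it gains at least one ball volume; this makes the slope positive.\<close>
    have disj: "cball (2 *\<^sub>R e) 1 \<inter> cball (-2 *\<^sub>R e) 1 = {}"
    proof -
      have "dist (2 *\<^sub>R e) (-2 *\<^sub>R e) = 4" using e by (simp add: dist_norm flip: scaleR_add_left)
      moreover have "dist (2 *\<^sub>R e) (-2 *\<^sub>R e) \<le> 1 + 1" if "z \<in> cball (2 *\<^sub>R e) 1" "z \<in> cball (-2 *\<^sub>R e) 1" for z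
        using dist_triangle2[of "2 *\<^sub>R e" "-2 *\<^sub>R e" z] that by simp
      ultimately show ?thesis by fastforce
    qed
    have "2 * ?\<omega> = measure lebesgue (cball (2 *\<^sub>R e) 1) + measure lebesgue (cball (-2 *\<^sub>R e) 1)"
      using measure_cball_scale[of 1 "2 *\<^sub>R e"] measure_cball_scale[of 1 "-2 *\<^sub>R e"] by simp
    also have "\<dots> = measure lebesgue (cball (2 *\<^sub>R e) 1 \<union> cball (-2 *\<^sub>R e) 1)"
      using disj by (subst measure_Un3) auto
    also have "\<dots> \<le> measure lebesgue (cball 0 1 + segm (2 *\<^sub>R e))"
    proof (rule measure_mono_fmeasurable)
      have sub: "cball (s *\<^sub>R e) 1 \<subseteq> cball 0 1 + segm (2 *\<^sub>R e)" if "s \<in> {-2..2}" for s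
      proof
        fix z assume "z \<in> cball (s *\<^sub>R e) 1"
        then have "z - s *\<^sub>R e \<in> cball 0 1" by (simp add: dist_norm norm_minus_commute)
        moreover have "s *\<^sub>R e \<in> segm (2 *\<^sub>R e)" using that by (simp only: segm_scaleR[of 2]) blast
        ultimately show "z \<in> cball 0 1 + segm (2 *\<^sub>R e)" by (metis set_plus_intro diff_add_cancel)
      qed
      show "cball (2 *\<^sub>R e) 1 \<union> cball (-2 *\<^sub>R e) 1 \<subseteq> cball 0 1 + segm (2 *\<^sub>R e)"
        using sub[of 2] sub[of "-2"] by simp
      show "cball 0 1 + segm (2 *\<^sub>R e) \<in> lmeasurable"
        by (intro compact_convex_lmeasurable compact_convex_plus compact_convex_cball compact_convex_segm) simp
    qed auto
    also have "\<dots> = ?\<omega> + 2 * segm_coeff e" by (simp add: measure_unit_ball_plus_segm)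
    finally have "?\<omega> \<le> 2 * segm_coeff e" by simp
    moreover have "0 < ?\<omega>" by simp
    ultimately show ?thesis by linarith
  qed
  ultimately show ?thesis by blast
qed

text \<open>The parallelogram spanned by a triangle in \<open>L\<close> is covered by \<open>L\<close> and its mirror image in the
  midpoint of \<open>b\<close> and \<open>x\<close>, which overlap in at least the diagonal from \<open>b\<close> to \<open>x\<close>; this bounds the
  parallel volume of \<open>L\<close> from below by half the perimeter of the triangle.\<close>

lemma parallel_volume_ge_perimeter:
  fixes L :: "'a::euclidean_space set"
  assumes L: "compact_convex L" and abx: "a \<in> L" "b \<in> L" "x \<in> L" and t: "0 < t"
    and \<kappa>: "\<And>w::'a. segm_coeff w = \<kappa> * norm w"
  shows "measure lebesgue (cball (0::'a) 1) * t ^ DIM('a)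
      + \<kappa> * (dist a b + dist a x + dist b x) / 4 * t ^ (DIM('a) - 1)
    \<le> measure lebesgue (L + cball 0 t)"
proof -
  \<comment> \<open>With the midpoint of \<open>b\<close> and \<open>x\<close> at the origin, the
    mirror image becomes -M and the vertices become -v-w, v-w and w-v.\<close>
  define m where "m = (1/2) *\<^sub>R (b + x)"
  define v w where "v = (1/2) *\<^sub>R (b - a)" and "w = (1/2) *\<^sub>R (x - a)"
  define M where "M = L + {-m}"
  have M: "compact_convex M" unfolding M_def by (intro compact_convex_plus L compact_convex_singleton)
  have "y - m \<in> M" if "y \<in> L" for y
    using set_plus_intro[OF that, of "-m" "{-m}"] by (simp add: M_def)
  moreover have "a - m = - v - w" "b - m = v - w" "x - m = w - v"
    by (simp_all add: m_def v_def w_def algebra_simps flip: scaleR_add_left)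
  ultimately have pts: "- v - w \<in> M" "v - w \<in> M" "w - v \<in> M" using abx by metis+
  have convM: "convex M" using M by (simp add: compact_convex_def)
  have diag: "segm (v - w) \<subseteq> M"
  proof -
    have "s *\<^sub>R (v - w) \<in> M" if "s \<in> {-1..1}" for s
    proof -
      have "((1 + s) / 2) *\<^sub>R (v - w) + ((1 - s) / 2) *\<^sub>R (w - v) \<in> M"
        using that by (intro convexD[OF convM] pts) (auto simp: field_simps)
      also have "((1 + s) / 2) *\<^sub>R (v - w) + ((1 - s) / 2) *\<^sub>R (w - v) = s *\<^sub>R (v - w)"
      proof -
        have "w - v = - (v - w)" by simp
        then show ?thesis by (simp only: scaleR_minus_right flip: scaleR_minus_left scaleR_add_left)
            (simp add: field_simps)
      qed
      finally show ?thesis .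
    qed
    then show ?thesis by (auto simp: segm_def)
  qed
  \<comment> \<open>The half of the parallelogram with \<alpha> + \<beta> at most 0 is the triangle
    itself; \<open>l\<close>, (1 + \<alpha>) / 2 and (1 + \<beta>) / 2 are the barycentric
    coordinates.\<close>
  have half: "\<alpha> *\<^sub>R v + \<beta> *\<^sub>R w \<in> M"
    if "\<alpha> \<in> {-1..1}" "\<beta> \<in> {-1..1}" "\<alpha> + \<beta> \<le> 0" for \<alpha> \<beta>
  proof -
    define l where "l = -(\<alpha> + \<beta>) / 2"
    have l: "0 \<le> l" "l \<le> 1" "l + (1 + \<alpha>) / 2 + (1 + \<beta>) / 2 = 1"
      using that by (auto simp: l_def field_simps)
    have "l *\<^sub>R (- v - w) + ((1 + \<alpha>) / 2) *\<^sub>R (v - w) + ((1 + \<beta>) / 2) *\<^sub>R (w - v) \<in> M"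
      using convex_sum[of "{0,1,2::nat}" M "\<lambda>i. if i = 0 then l else if i = 1 then (1 + \<alpha>) / 2 else (1 + \<beta>) / 2"
          "\<lambda>i. if i = 0 then - v - w else if i = 1 then v - w else w - v"] convM l pts that
      by (simp add: add.assoc)
    also have "l *\<^sub>R (- v - w) + ((1 + \<alpha>) / 2) *\<^sub>R (v - w) + ((1 + \<beta>) / 2) *\<^sub>R (w - v)
        = (- l + (1 + \<alpha>) / 2 - (1 + \<beta>) / 2) *\<^sub>R v + (- l - (1 + \<alpha>) / 2 + (1 + \<beta>) / 2) *\<^sub>R w"
      by (simp add: scaleR_diff_right scaleR_diff_left scaleR_add_left scaleR_minus_left)
    also have "\<dots> = \<alpha> *\<^sub>R v + \<beta> *\<^sub>R w"
      by (rule arg_cong2[where f="\<lambda>p q. p *\<^sub>R v + q *\<^sub>R w"]) (auto simp: l_def field_simps)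
    finally show ?thesis .
  qed
  let ?N = "(*\<^sub>R) (-1) ` M"
  have par: "segm v + segm w \<subseteq> M \<union> ?N"
  proof
    fix z assume "z \<in> segm v + segm w"
    then obtain \<alpha> \<beta> where z: "\<alpha> \<in> {-1..1}" "\<beta> \<in> {-1..1}" "z = \<alpha> *\<^sub>R v + \<beta> *\<^sub>R w"
      by (auto simp: segm_def set_plus_def)
    show "z \<in> M \<union> ?N"
    proof (cases "\<alpha> + \<beta> \<le> 0")
      case True
      then show ?thesis using half z by simp
    next
      case False
      then have "(-\<alpha>) *\<^sub>R v + (-\<beta>) *\<^sub>R w \<in> M" using z by (intro half) auto
      moreover have "z = (-1) *\<^sub>R ((-\<alpha>) *\<^sub>R v + (-\<beta>) *\<^sub>R w)" using z by simp
      ultimately show ?thesis by blast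
    qed
  qed
  have diag': "segm (v - w) \<subseteq> ?N"
  proof -
    have "(*\<^sub>R) (-1) ` segm (v - w) = segm (v - w)"
      unfolding linear_image_segm[OF linear_scale_self] scaleR_minus1_left by (rule segm_uminus)
    then show ?thesis using image_mono[OF diag, of "(*\<^sub>R) (-1)"] by simp
  qed
  have ccN: "compact_convex ?N"
    using M compact_scaling[of M "-1"] convex_scaling[of M "-1"]
    unfolding compact_convex_def by blast
  have ccB: "compact_convex (cball (0::'a) t)" using t by (simp add: compact_convex_cball)
  let ?P = "M + cball 0 t" and ?R = "?N + cball 0 t"
  have PR: "?P \<in> lmeasurable" "?R \<in> lmeasurable"
    by (intro compact_convex_lmeasurable compact_convex_plus M ccN ccB)+
  have "?R = (*\<^sub>R) (-1) ` ?P"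
  proof -
    have "(*\<^sub>R) (-1) ` cball (0::'a) t = cball 0 t" using cball_scale[of "-1" "0::'a" t] by simp
    then show ?thesis by (simp only: linear_image_plus[OF linear_scale_self])
  qed
  then have R: "measure lebesgue ?R = measure lebesgue ?P" by (simp only: measure_scaleR_image) simp
  have "measure lebesgue (cball 0 t + segm v + segm w) \<le> measure lebesgue (?P \<union> ?R)"
  proof (rule measure_mono_fmeasurable)
    have "cball 0 t + segm v + segm w = (segm v + segm w) + cball 0 t" by (simp add: ac_simps)
    also have "\<dots> \<subseteq> (M \<union> ?N) + cball 0 t" by (intro set_plus_mono2 par) simp
    finally show "cball 0 t + segm v + segm w \<subseteq> ?P \<union> ?R" by (simp only: Un_set_plus)
    show "cball 0 t + segm v + segm w \<in> sets lebesgue"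
      by (intro fmeasurableD compact_convex_lmeasurable compact_convex_plus ccB compact_convex_segm)
    show "?P \<union> ?R \<in> lmeasurable" using PR by (rule fmeasurable.Un)
  qed
  moreover have "measure lebesgue (cball 0 t + segm (v - w)) \<le> measure lebesgue (?P \<inter> ?R)"
  proof (rule measure_mono_fmeasurable)
    have "cball 0 t + segm (v - w) = segm (v - w) + cball 0 t" by (simp add: ac_simps)
    then show "cball 0 t + segm (v - w) \<subseteq> ?P \<inter> ?R"
      using set_plus_mono2[OF diag order_refl, of "cball 0 t"]
        set_plus_mono2[OF diag' order_refl, of "cball 0 t"] by (simp only: Int_subset_iff)
    show "cball 0 t + segm (v - w) \<in> sets lebesgue"
      by (intro fmeasurableD compact_convex_lmeasurable compact_convex_plus ccB compact_convex_segm)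
    show "?P \<inter> ?R \<in> lmeasurable" using PR by (rule fmeasurable.Int)
  qed
  moreover have "measure lebesgue (?P \<union> ?R) + measure lebesgue (?P \<inter> ?R)
      = measure lebesgue ?P + measure lebesgue ?R"
    using measure_Un3[OF PR] by simp
  moreover have "measure lebesgue ?P = measure lebesgue (L + cball 0 t)"
  proof -
    have "?P = (L + cball 0 t) + {-m}" by (simp add: M_def ac_simps)
    then show ?thesis by (simp only: measure_translation_singleton)
  qed
  ultimately have "measure lebesgue (cball 0 t + segm v + segm w)
      + measure lebesgue (cball 0 t + segm (v - w)) \<le> 2 * measure lebesgue (L + cball 0 t)"
    using R by linarith
  moreover note measure_cball_plus_two_segm_ge[OF t, of v w] measure_cball_plus_segm[OF t, of "v - w"]
  \<comment> \<open>The vectors v, w and v - w are half edges, so together they contribute \<kappa>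
    times half the perimeter to twice the volume; hence the factor 1/4.\<close>
  moreover have "segm_coeff v = \<kappa> * (dist a b / 2)" "segm_coeff w = \<kappa> * (dist a x / 2)"
    "segm_coeff (v - w) = \<kappa> * (dist b x / 2)"
  proof -
    have "v - w = (1/2) *\<^sub>R (b - x)" by (simp add: v_def w_def flip: scaleR_diff_right)
    then show "segm_coeff v = \<kappa> * (dist a b / 2)" "segm_coeff w = \<kappa> * (dist a x / 2)"
      "segm_coeff (v - w) = \<kappa> * (dist b x / 2)"
      by (simp_all add: \<kappa> v_def w_def dist_norm norm_minus_commute)
  qed
  ultimately show ?thesis by (simp add: algebra_simps add_divide_distrib)
qed

subsection \<open>The rolling theorem\<close>

definition support_fun :: "'a::euclidean_space set \<Rightarrow> 'a \<Rightarrow> real" where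
  "support_fun K u = (SUP x\<in>K. u \<bullet> x)"

lemma support_fun_ge: "compact K \<Longrightarrow> x \<in> K \<Longrightarrow> u \<bullet> x \<le> support_fun K u"
  unfolding support_fun_def
  by (intro cSUP_upper bounded_imp_bdd_above compact_imp_bounded compact_continuous_image
      continuous_intros)

lemma support_fun_attained:
  assumes "compact K" "K \<noteq> {}"
  obtains p where "p \<in> K" "support_fun K u = u \<bullet> p"
proof -
  have "continuous_on K (\<lambda>x. u \<bullet> x)" by (intro continuous_intros)
  then obtain p where p: "p \<in> K" "\<And>x. x \<in> K \<Longrightarrow> u \<bullet> x \<le> u \<bullet> p"
    using continuous_attains_sup[OF assms] by blast
  then have "support_fun K u = u \<bullet> p"
    unfolding support_fun_def by (intro cSup_eq_maximum) auto
  then show ?thesis using that p by blast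
qed

lemma continuous_on_support_fun:
  assumes "compact K" "K \<noteq> {}"
  shows "continuous_on UNIV (support_fun K)"
proof -
  obtain R where R: "0 < R" "\<And>x. x \<in> K \<Longrightarrow> norm x \<le> R"
    using compact_imp_bounded[OF assms(1)] bounded_pos by blast
  have le: "support_fun K u - support_fun K v \<le> R * dist u v" for u v
  proof -
    obtain p where p: "p \<in> K" "support_fun K u = u \<bullet> p" using support_fun_attained[OF assms] .
    have "support_fun K u - support_fun K v \<le> (u - v) \<bullet> p"
      using p support_fun_ge[OF assms(1) p(1), of v] by (simp add: inner_diff_left)
    also have "\<dots> \<le> norm (u - v) * norm p" by (rule norm_cauchy_schwarz)
    also have "\<dots> \<le> norm (u - v) * R" using R(2)[OF p(1)] by (intro mult_left_mono) auto
    finally show ?thesis by (simp add: dist_norm mult.commute)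
  qed
  have "R-lipschitz_on UNIV (support_fun K)"
  proof (rule lipschitz_onI)
    show "dist (support_fun K u) (support_fun K v) \<le> R * dist u v" for u v
      using le[of u v] le[of v u] by (simp add: dist_real_def abs_le_iff dist_commute)
  qed (use R(1) in simp)
  then show ?thesis by (rule lipschitz_on_continuous_on)
qed

lemma mem_if_below_support_fun:
  assumes K: "compact_convex K" and x: "\<And>u. u \<noteq> 0 \<Longrightarrow> u \<bullet> x \<le> support_fun K u"
  shows "x \<in> K"
proof (rule ccontr)
  assume "x \<notin> K"
  then obtain v \<beta> where v: "v \<bullet> x < \<beta>" "\<And>z. z \<in> K \<Longrightarrow> \<beta> < v \<bullet> z"
    using separating_hyperplane_closed_point[of K x] K
    by (auto simp: compact_convex_def compact_imp_closed)
  obtain p where p: "p \<in> K" "support_fun K (-v) = (-v) \<bullet> p"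
    using K support_fun_attained[of K "-v"] by (auto simp: compact_convex_def)
  have "v \<noteq> 0" using v(1) v(2)[OF p(1)] by auto
  then have "(-v) \<bullet> x \<le> support_fun K (-v)" by (intro x) simp
  then show False using p(2) v(1) v(2)[OF p(1)] by simp
qed

lemma support_point_frontier:
  assumes "compact K" "p \<in> K" "u \<noteq> 0" "support_fun K u = u \<bullet> p"
  shows "p \<in> frontier K"
proof -
  have "p \<notin> interior K"
  proof
    assume "p \<in> interior K"
    then obtain e where e: "0 < e" "cball p e \<subseteq> K" unfolding mem_interior_cball by blast
    have "p + (e / norm u) *\<^sub>R u \<in> cball p e" using e assms(3) by (simp add: dist_norm)
    then have "p + (e / norm u) *\<^sub>R u \<in> K" using e by blast
    then have "u \<bullet> (p + (e / norm u) *\<^sub>R u) \<le> u \<bullet> p" using support_fun_ge[OF assms(1)] assms(4) by metis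
    then have "(e / norm u) * (u \<bullet> u) \<le> 0" by (simp add: inner_add_right)
    moreover have "0 < (e / norm u) * (u \<bullet> u)" using e assms(3) by simp
    ultimately show False by simp
  qed
  then show ?thesis using assms(2) closure_subset by (auto simp: frontier_def)
qed

text \<open>The support function of a ball of radius r about c is v . c + r |v|. The local ball at a
  support point of direction \<open>u\<close> must be tangent there, so it supports \<open>K\<close>
  in direction \<open>u\<close>; and for nearby directions its farthest point is still close enough
  to lie in \<open>K\<close>.\<close>

lemma local_ball_support:
  fixes K :: "'a::euclidean_space set"
  assumes K: "compact_convex K" and r: "0 < r" and u: "u \<noteq> 0"
    and conc: "\<And>p. p \<in> frontier K \<Longrightarrow> \<exists>c. p \<in> sphere c r \<and>
        (\<exists>U. open U \<and> p \<in> U \<and> cball c r \<inter> U \<subseteq> K \<inter> U)"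
  shows "\<exists>c. support_fun K u = u \<bullet> c + r * norm u \<and>
    (\<forall>\<^sub>F v in nhds u. v \<bullet> c + r * norm v \<le> support_fun K v)"
proof -
  have cK: "compact K" "K \<noteq> {}" using K by (auto simp: compact_convex_def)
  obtain p where p: "p \<in> K" "support_fun K u = u \<bullet> p" using support_fun_attained[OF cK] .
  obtain c U where c: "dist c p = r" "open U" "p \<in> U" "cball c r \<inter> U \<subseteq> K"
    using conc[OF support_point_frontier[OF cK(1) p(1) u p(2)]] by auto
  \<comment> \<open>The farthest point of the ball in direction \<open>u\<close>. Were it beyond
    \<open>p\<close>, a short step from \<open>p\<close> towards it would stay in the ball and in
    \<open>U\<close>, hence in \<open>K\<close>, yet exceed the support value. Equality in
    Cauchy-Schwarz then identifies it with \<open>p\<close>.\<close>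
  define n where "n = c + (r / norm u) *\<^sub>R u"
  have nball: "n \<in> cball c r" using u r by (simp add: n_def dist_norm)
  have un: "u \<bullet> n = u \<bullet> c + r * norm u"
    using u by (simp add: n_def inner_add_right dot_square_norm power2_eq_square)
  have "((\<lambda>s. p + s *\<^sub>R (n - p)) \<longlongrightarrow> p + 0 *\<^sub>R (n - p)) (at_right 0)"
    by (intro tendsto_intros)
  then have "\<forall>\<^sub>F s in at_right (0::real). p + s *\<^sub>R (n - p) \<in> U"
    using c(2,3) by (intro topological_tendstoD) auto
  moreover have "\<forall>\<^sub>F s in at_right (0::real). 0 < s \<and> s < 1"
    using eventually_at_right_real[of 0 1] by (rule eventually_mono) auto
  ultimately have "\<forall>\<^sub>F s in at_right (0::real). 0 < s \<and> s < 1 \<and> p + s *\<^sub>R (n - p) \<in> U"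
    by eventually_elim auto
  then obtain s :: real where s: "0 < s" "s < 1" "p + s *\<^sub>R (n - p) \<in> U"
    using eventually_happens'[OF trivial_limit_at_right_real] by blast
  have "p + s *\<^sub>R (n - p) \<in> cball c r"
  proof -
    have "(1 - s) *\<^sub>R p + s *\<^sub>R n \<in> cball c r"
      using nball c(1) s by (intro convexD_alt[OF convex_cball]) auto
    then show ?thesis by (simp add: algebra_simps)
  qed
  then have "p + s *\<^sub>R (n - p) \<in> K" using s(3) c(4) by blast
  then have "u \<bullet> (p + s *\<^sub>R (n - p)) \<le> u \<bullet> p" using support_fun_ge[OF cK(1)] p(2) by metis
  then have "s * (u \<bullet> (n - p)) \<le> 0" by (simp add: inner_add_right)
  then have "u \<bullet> n \<le> u \<bullet> p" using s(1) by (simp add: mult_le_0_iff inner_diff_right)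
  moreover have "u \<bullet> p \<le> u \<bullet> c + norm u * norm (p - c)"
    using norm_cauchy_schwarz[of u "p - c"] by (simp add: inner_diff_right)
  moreover have nr: "norm (p - c) = r" using c(1) by (simp add: dist_norm norm_minus_commute)
  ultimately have eq: "u \<bullet> p = u \<bullet> c + r * norm u" using un by (simp add: mult.commute)
  then have "u \<bullet> (p - c) = norm u * norm (p - c)" using nr by (simp add: inner_diff_right mult.commute)
  then have "norm u *\<^sub>R (p - c) = r *\<^sub>R u" using nr norm_cauchy_schwarz_eq by metis
  then have "p - c = (r / norm u) *\<^sub>R u"
    using u by (metis divide_inverse_commute norm_eq_zero scaleR_left_imp_eq scaleR_scaleR nonzero_divide_eq_eq mult.commute)
  then have pn: "c + (r / norm u) *\<^sub>R u = p" by (simp add: algebra_simps)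
  have "((\<lambda>v. c + (r / norm v) *\<^sub>R v) \<longlongrightarrow> c + (r / norm u) *\<^sub>R u) (nhds u)"
    using u by (intro tendsto_intros filterlim_ident) auto
  then have "\<forall>\<^sub>F v in nhds u. c + (r / norm v) *\<^sub>R v \<in> U"
    using c(2,3) pn by (intro topological_tendstoD) auto
  moreover have "\<forall>\<^sub>F v in nhds u. v \<noteq> 0"
    using u by (intro t1_space_nhds) auto
  ultimately have "\<forall>\<^sub>F v in nhds u. v \<bullet> c + r * norm v \<le> support_fun K v"
  proof eventually_elim
    case (elim v)
    have "c + (r / norm v) *\<^sub>R v \<in> cball c r" using elim r by (simp add: dist_norm)
    then have "c + (r / norm v) *\<^sub>R v \<in> K" using elim c(4) by blast
    then have "v \<bullet> (c + (r / norm v) *\<^sub>R v) \<le> support_fun K v" by (rule support_fun_ge[OF cK(1)])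
    moreover have "v \<bullet> (c + (r / norm v) *\<^sub>R v) = v \<bullet> c + r * norm v"
      using elim by (simp add: inner_add_right dot_square_norm power2_eq_square)
    ultimately show ?case by simp
  qed
  then show ?thesis using p(2) eq by auto
qed

text \<open>A maximum principle in place of convexity: if \<open>\<phi> 1\<close> were negative,
  subtracting the chord would leave a function that vanishes at both ends and is positive near 0. A
  local supporting line at an interior maximum forces constancy nearby, which the rightmost maximum
  excludes.\<close>

lemma locally_supported_nonneg:
  fixes \<phi> :: "real \<Rightarrow> real"
  assumes cont: "continuous_on {0..1} \<phi>"
    and supp: "\<And>t. t \<in> {0..1} \<Longrightarrow> \<exists>m. \<forall>\<^sub>F s in nhds t. \<phi> t + m * (s - t) \<le> \<phi> s"
    and 0: "\<phi> 0 = 0" "\<forall>\<^sub>F s in nhds 0. 0 \<le> \<phi> s"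
  shows "0 \<le> \<phi> 1"
proof (rule ccontr)
  assume neg: "\<not> 0 \<le> \<phi> 1"
  define \<psi> where "\<psi> s = \<phi> s - s * \<phi> 1" for s
  have cont': "continuous_on {0..1} \<psi>" unfolding \<psi>_def by (intro continuous_intros cont)
  obtain a where a: "a \<in> {0..1}" "\<And>s. s \<in> {0..1} \<Longrightarrow> \<psi> s \<le> \<psi> a"
    using continuous_attains_sup[OF compact_Icc _ cont'] by auto
  have pos: "0 < \<psi> a"
  proof -
    obtain d where d: "0 < d" "\<And>s. dist s 0 < d \<Longrightarrow> 0 \<le> \<phi> s"
      using 0(2) unfolding eventually_nhds_metric by blast
    define s where "s = min (d / 2) 1"
    have s: "0 < s" "s \<le> 1" "s < d" using d(1) by (auto simp: s_def)
    have "s * \<phi> 1 < 0" using s neg by (simp add: mult_pos_neg)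
    then have "0 < \<psi> s" using d(2)[of s] s by (simp add: \<psi>_def)
    then show ?thesis using a(2)[of s] s by simp
  qed
  define A where "A = {s \<in> {0..1}. \<psi> s = \<psi> a}"
  have "compact A"
  proof -
    have "closed A" unfolding A_def
      by (rule continuous_closed_preimage_constant[OF cont' closed_atLeastAtMost])
    moreover have "bounded A" by (rule bounded_subset[of "{0..1}"]) (auto simp: A_def)
    ultimately show ?thesis by (simp add: compact_eq_bounded_closed)
  qed
  moreover have "A \<noteq> {}" using a by (auto simp: A_def)
  ultimately obtain b where b: "b \<in> A" "\<And>s. s \<in> A \<Longrightarrow> s \<le> b"
    using compact_attains_sup by metis
  have b01: "b \<in> {0..1}" and \<psi>b: "\<psi> b = \<psi> a" using b(1) by (auto simp: A_def)
  have "b \<noteq> 1" "b \<noteq> 0" using \<psi>b pos 0(1) by (auto simp: \<psi>_def)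
  then have b1: "0 < b" "b < 1" using b01 by auto
  obtain m where m: "\<forall>\<^sub>F s in nhds b. \<phi> b + m * (s - b) \<le> \<phi> s" using supp[OF b01] by blast
  obtain d where d: "0 < d" "\<And>s. dist s b < d \<Longrightarrow> \<phi> b + m * (s - b) \<le> \<phi> s"
    using m unfolding eventually_nhds_metric by blast
  define e where "e = min (d / 2) (min b (1 - b))"
  have e: "0 < e" "e < d" "e \<le> b" "e \<le> 1 - b" using d(1) b1 by (auto simp: e_def)
  have up: "\<psi> b + (m - \<phi> 1) * (s - b) \<le> \<psi> s" if "dist s b < d" for s
    using d(2)[OF that] by (simp add: \<psi>_def algebra_simps)
  \<comment> \<open>Adding the two bounds cancels the slope, so the values at b + e and b - e sum to
    at least twice the maximum and both equal it.\<close>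
  have "\<psi> b + (m - \<phi> 1) * e \<le> \<psi> (b + e)" "\<psi> b - (m - \<phi> 1) * e \<le> \<psi> (b - e)"
    using up[of "b + e"] up[of "b - e"] e by (auto simp: dist_real_def)
  moreover have "\<psi> (b + e) \<le> \<psi> b" "\<psi> (b - e) \<le> \<psi> b" using a(2) e b1 \<psi>b by auto
  ultimately have "\<psi> (b + e) = \<psi> b" by linarith
  then have "b + e \<in> A" using \<psi>b e b1 by (simp add: A_def)
  then show False using b(2) e(1) by fastforce
qed

text \<open>The local ball in direction \<open>u\<close> is shown to lie entirely in
  \<open>K\<close>. On a segment of directions the difference between the support function of
  \<open>K\<close> and that of the ball meets the hypotheses of
  \<open>locally_supported_nonneg\<close>, provided the segment avoids 0.\<close>

lemma global_ball_support:
  fixes K :: "'a::euclidean_space set"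
  assumes dim: "2 \<le> DIM('a)" and K: "compact_convex K" and r: "0 < r" and u: "u \<noteq> 0"
    and conc: "\<And>p. p \<in> frontier K \<Longrightarrow> \<exists>c. p \<in> sphere c r \<and>
        (\<exists>U. open U \<and> p \<in> U \<and> cball c r \<inter> U \<subseteq> K \<inter> U)"
  shows "\<exists>c. cball c r \<subseteq> K \<and> support_fun K u = u \<bullet> c + r * norm u"
proof -
  let ?h = "support_fun K"
  have conth: "continuous_on A ?h" for A
    using continuous_on_support_fun[of K] K continuous_on_subset by (auto simp: compact_convex_def)
  note loc = local_ball_support[OF K r _ conc]
  obtain c where c: "?h u = u \<bullet> c + r * norm u"
    "\<forall>\<^sub>F v in nhds u. v \<bullet> c + r * norm v \<le> ?h v"
    using loc[OF u] by blast
  have seg: "v \<bullet> c + r * norm v \<le> ?h v" if v: "0 \<notin> closed_segment u v" for v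
  proof -
    define z where "z s = (1 - s) *\<^sub>R u + s *\<^sub>R v" for s :: real
    have ztend: "(z \<longlongrightarrow> z t) (nhds t)" for t
      unfolding z_def by (intro tendsto_intros filterlim_ident)
    have z0: "z 0 = u" and z1: "z 1 = v" by (simp_all add: z_def)
    have znz: "z t \<noteq> 0" if "t \<in> {0..1}" for t
      using v that by (force simp: z_def in_segment)
    define \<phi> where "\<phi> s = ?h (z s) - r * norm (z s) - z s \<bullet> c" for s
    have "0 \<le> \<phi> 1"
    proof (rule locally_supported_nonneg)
      show "continuous_on {0..1} \<phi>"
        unfolding \<phi>_def z_def
        by (intro continuous_intros continuous_on_compose2[OF conth[of UNIV]]) auto
      show "\<phi> 0 = 0" by (simp add: \<phi>_def z0 c(1))
      show "\<forall>\<^sub>F s in nhds 0. 0 \<le> \<phi> s"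
        using c(2) ztend[of 0] unfolding z0 filterlim_iff \<phi>_def
        by (fastforce elim: eventually_mono)
      show "\<exists>m. \<forall>\<^sub>F s in nhds t. \<phi> t + m * (s - t) \<le> \<phi> s" if t: "t \<in> {0..1}" for t
      proof -
        \<comment> \<open>Comparing this ball with the one centred at \<open>c\<close>, the terms r
          |z| cancel and leave z . (d - c), which is affine in the parameter with slope (v - u) . (d
          - c).\<close>
        obtain d where d: "?h (z t) = z t \<bullet> d + r * norm (z t)"
          "\<forall>\<^sub>F v in nhds (z t). v \<bullet> d + r * norm v \<le> ?h v"
          using loc[OF znz[OF t]] by blast
        have ev: "\<forall>\<^sub>F s in nhds t. z s \<bullet> d + r * norm (z s) \<le> ?h (z s)"
          using d(2) ztend[of t] unfolding filterlim_iff by blast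
        have "\<forall>\<^sub>F s in nhds t. \<phi> t + ((v - u) \<bullet> (d - c)) * (s - t) \<le> \<phi> s"
          using ev
        proof eventually_elim
          case (elim s)
          have "\<phi> t + ((v - u) \<bullet> (d - c)) * (s - t) = z s \<bullet> (d - c)"
            unfolding \<phi>_def d(1) by (simp add: z_def inner_simps algebra_simps)
          also have "\<dots> \<le> \<phi> s" using elim by (simp add: \<phi>_def inner_diff_right)
          finally show ?case .
        qed
        then show ?thesis by blast
      qed
    qed
    then show ?thesis by (simp add: \<phi>_def z1)
  qed
  have all: "v \<bullet> c + r * norm v \<le> ?h v" for v
  proof (cases "0 \<in> closed_segment u v")
    case False
    then show ?thesis by (rule seg)
  next
    case True
    \<comment> \<open>Here \<open>v\<close> is a multiple of \<open>u\<close>. Tilting it by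
      \<epsilon> w with \<open>w\<close> orthogonal to \<open>u\<close> moves the segment off the
      origin, and continuity of the support function lets \<epsilon> tend to 0.\<close>
    obtain w where w: "w \<noteq> 0" "orthogonal u w" using orthogonal_to_vector_exists[OF dim] by metis
    obtain s where s: "0 \<le> s" "s \<le> 1" "(1 - s) *\<^sub>R u + s *\<^sub>R v = 0" using True by (auto simp: in_segment)
    have "s \<noteq> 0" using s u by auto
    then have "v = (- ((1 - s) / s)) *\<^sub>R u"
    proof -
      have "s *\<^sub>R v = s *\<^sub>R ((- ((1 - s) / s)) *\<^sub>R u)"
      proof -
        have "s *\<^sub>R v = - ((1 - s) *\<^sub>R u)" using s(3) by (simp add: eq_neg_iff_add_eq_0 add.commute)
        then show ?thesis using \<open>s \<noteq> 0\<close> by simp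
      qed
      then show ?thesis using \<open>s \<noteq> 0\<close> scaleR_left_imp_eq by blast
    qed
    then obtain k where k: "v = k *\<^sub>R u" by blast
    have miss: "0 \<notin> closed_segment u (v + \<epsilon> *\<^sub>R w)" if "\<epsilon> \<noteq> 0" for \<epsilon>
    proof
      assume "0 \<in> closed_segment u (v + \<epsilon> *\<^sub>R w)"
      then obtain s where s: "(1 - s) *\<^sub>R u + s *\<^sub>R (v + \<epsilon> *\<^sub>R w) = 0" by (auto simp: in_segment)
      have "w \<bullet> ((1 - s) *\<^sub>R u + s *\<^sub>R (v + \<epsilon> *\<^sub>R w)) = s * \<epsilon> * (w \<bullet> w)"
        using w(2) by (simp add: k inner_simps orthogonal_def inner_commute)
      then have "s = 0" using s that w(1) by simp
      then show False using s u by simp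
    qed
    have "((\<lambda>\<epsilon>. ?h (v + \<epsilon> *\<^sub>R w) - ((v + \<epsilon> *\<^sub>R w) \<bullet> c + r * norm (v + \<epsilon> *\<^sub>R w)))
        \<longlongrightarrow> ?h (v + 0 *\<^sub>R w) - ((v + 0 *\<^sub>R w) \<bullet> c + r * norm (v + 0 *\<^sub>R w))) (at_right 0)"
      by (intro tendsto_intros isCont_tendsto_compose[of _ ?h])
        (use conth[of UNIV] in \<open>auto simp: continuous_on_eq_continuous_at\<close>)
    moreover have "\<forall>\<^sub>F \<epsilon> in at_right (0::real).
        0 \<le> ?h (v + \<epsilon> *\<^sub>R w) - ((v + \<epsilon> *\<^sub>R w) \<bullet> c + r * norm (v + \<epsilon> *\<^sub>R w))"
      using eventually_at_right_less[of 0] by eventually_elim (use seg[OF miss] in auto)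
    ultimately have "0 \<le> ?h (v + 0 *\<^sub>R w) - ((v + 0 *\<^sub>R w) \<bullet> c + r * norm (v + 0 *\<^sub>R w))"
      by (rule tendsto_lowerbound) simp
    then show ?thesis by simp
  qed
  have "cball c r \<subseteq> K"
  proof
    fix x assume x: "x \<in> cball c r"
    show "x \<in> K"
    proof (rule mem_if_below_support_fun[OF K])
      fix v
      have "v \<bullet> x = v \<bullet> c + v \<bullet> (x - c)" by (simp add: inner_diff_right)
      also have "v \<bullet> (x - c) \<le> norm v * norm (x - c)" by (rule norm_cauchy_schwarz)
      also have "norm v * norm (x - c) \<le> norm v * r"
        using x by (intro mult_left_mono) (auto simp: dist_norm norm_minus_commute)
      finally show "v \<bullet> x \<le> ?h v" using all[of v] by (simp add: mult.commute)
    qed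
  qed
  then show ?thesis using c(1) by blast
qed

text \<open>\<open>L\<close> is the inner parallel body, the set of centres of balls of radius r in
  \<open>K\<close>. In each direction one of these balls reaches the supporting hyperplane of
  \<open>K\<close>, so the sum has the same support function as \<open>K\<close>.\<close>

lemma lambda_concave_decomposition:
  fixes K :: "'a::euclidean_space set"
  assumes dim: "2 \<le> DIM('a)" and K: "compact_convex K" and r: "0 < r"
    and conc: "\<And>p. p \<in> frontier K \<Longrightarrow> \<exists>c. p \<in> sphere c r \<and>
        (\<exists>U. open U \<and> p \<in> U \<and> cball c r \<inter> U \<subseteq> K \<inter> U)"
  shows "\<exists>L. compact_convex L \<and> K = L + cball 0 r"
proof -
  define L where "L = {x. cball x r \<subseteq> K}"
  note ball = global_ball_support[OF dim K r _ conc]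
  have Leq: "L = (\<Inter>y\<in>cball 0 r. (+) (-y) ` K)"
  proof -
    have tr: "cball x r = (+) x ` cball 0 r" for x :: 'a by (simp flip: cball_translation)
    have "x \<in> L \<longleftrightarrow> (\<forall>y\<in>cball 0 r. x + y \<in> K)" for x
      unfolding L_def mem_Collect_eq tr[of x] by (rule image_subset_iff)
    moreover have "x \<in> (+) (-y) ` K \<longleftrightarrow> x + y \<in> K" for x y :: 'a
    proof
      assume "x \<in> (+) (-y) ` K"
      then obtain k where "k \<in> K" "x = -y + k" by blast
      then show "x + y \<in> K" by simp
    next
      assume "x + y \<in> K"
      moreover have "x = -y + (x + y)" by simp
      ultimately show "x \<in> (+) (-y) ` K" by (rule rev_image_eqI)
    qed
    ultimately show ?thesis by (simp only: set_eq_iff INT_iff simp_thms)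
  qed
  obtain e :: 'a where e: "e \<noteq> 0" using vector_choose_size[of 1] by force
  have "L \<noteq> {}" using ball[OF e] by (auto simp: L_def)
  moreover have "compact L"
  proof -
    have "closed L" unfolding Leq
      using K by (intro closed_INT ballI closed_translation) (auto simp: compact_convex_def compact_imp_closed)
    moreover have "L \<subseteq> K" using r by (auto simp: L_def)
    ultimately show ?thesis using K unfolding compact_convex_def
      by (metis compact_Int_closed inf.absorb_iff2)
  qed
  moreover have "convex L" unfolding Leq
    using K by (intro convex_INT convex_translation) (auto simp: compact_convex_def)
  ultimately have L: "compact_convex L" by (simp add: compact_convex_def)
  then have LB: "compact_convex (L + cball 0 r)" using r by (intro compact_convex_plus compact_convex_cball) auto
  have "L + cball 0 r \<subseteq> K"
  proof
    fix z assume "z \<in> L + cball 0 r"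
    then obtain x y where "x \<in> L" "y \<in> cball 0 r" "z = x + y" by (auto elim: set_plus_elim)
    then have "z \<in> cball x r" "cball x r \<subseteq> K" by (simp_all add: L_def dist_norm)
    then show "z \<in> K" by blast
  qed
  moreover have "K \<subseteq> L + cball 0 r"
  proof
    fix x assume x: "x \<in> K"
    show "x \<in> L + cball 0 r"
    proof (rule mem_if_below_support_fun[OF LB])
      fix u :: 'a assume u: "u \<noteq> 0"
      obtain c where c: "cball c r \<subseteq> K" "support_fun K u = u \<bullet> c + r * norm u" using ball[OF u] by blast
      have "c + (r / norm u) *\<^sub>R u \<in> L + cball 0 r"
        using c(1) u r by (intro set_plus_intro) (auto simp: L_def)
      then have "u \<bullet> (c + (r / norm u) *\<^sub>R u) \<le> support_fun (L + cball 0 r) u"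
        using LB by (intro support_fun_ge) (auto simp: compact_convex_def)
      moreover have "u \<bullet> (c + (r / norm u) *\<^sub>R u) = support_fun K u"
        using u by (simp add: c(2) inner_add_right dot_square_norm power2_eq_square)
      moreover have "u \<bullet> x \<le> support_fun K u"
        using K x by (intro support_fun_ge) (auto simp: compact_convex_def)
      ultimately show "u \<bullet> x \<le> support_fun (L + cball 0 r) u" by simp
    qed
  qed
  ultimately show ?thesis using L by blast
qed

subsection \<open>Sausage bodies\<close>

lemma diameter_plus_cball:
  fixes L :: "'a::euclidean_space set"
  assumes L: "compact L" "L \<noteq> {}" and r: "0 \<le> r"
  shows "diameter (L + cball 0 r) = diameter L + 2 * r"
proof (rule antisym)
  obtain a b where ab: "a \<in> L" "b \<in> L" "dist a b = diameter L"
    using diameter_compact_attained[OF L] by blast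
  have bL: "bounded L" using L(1) by (rule compact_imp_bounded)
  show "diameter (L + cball 0 r) \<le> diameter L + 2 * r"
  proof (rule diameter_le)
    show "L + cball 0 r \<noteq> {} \<or> 0 \<le> diameter L + 2 * r"
      using diameter_ge_0[OF bL] r by simp
    fix x y assume "x \<in> L + cball 0 r" "y \<in> L + cball 0 r"
    then obtain p q u v where pq: "p \<in> L" "q \<in> L" "norm u \<le> r" "norm v \<le> r" "x = p + u" "y = q + v"
      by (auto elim!: set_plus_elim)
    have "norm (x - y) = norm ((p - q) + (u - v))" by (simp add: pq algebra_simps)
    also have "\<dots> \<le> norm (p - q) + norm (u - v)" by (rule norm_triangle_ineq)
    also have "norm (p - q) \<le> diameter L"
      using diameter_bounded_bound[OF bL pq(1,2)] by (simp add: dist_norm)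
    also have "norm (u - v) \<le> norm u + norm v" by (rule norm_triangle_ineq4)
    finally show "norm (x - y) \<le> diameter L + 2 * r" using pq by simp
  qed
  \<comment> \<open>The unit direction of a diametral pair; when \<open>L\<close> is a single point,
    any unit vector will do.\<close>
  obtain e :: 'a where e: "norm e = 1" "a - b = dist a b *\<^sub>R e"
  proof (cases "a = b")
    case True
    obtain e :: 'a where "norm e = 1" using vector_choose_size[of 1] by auto
    then show ?thesis using True that by simp
  next
    case False
    then show ?thesis by (intro that[of "(a - b) /\<^sub>R norm (a - b)"]) (auto simp: dist_norm)
  qed
  have "a + r *\<^sub>R e \<in> L + cball 0 r" "b + (- r) *\<^sub>R e \<in> L + cball 0 r"
    by (intro set_plus_intro ab; use e(1) r in simp)+
  moreover have "bounded (L + cball 0 r)"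
    by (intro compact_imp_bounded compact_set_plus L compact_cball)
  ultimately have "dist (a + r *\<^sub>R e) (b + (- r) *\<^sub>R e) \<le> diameter (L + cball 0 r)"
    by (intro diameter_bounded_bound)
  moreover have "dist (a + r *\<^sub>R e) (b + (- r) *\<^sub>R e) = diameter L + 2 * r"
  proof -
    have "(a + r *\<^sub>R e) - (b + (- r) *\<^sub>R e) = (a - b) + (2 * r) *\<^sub>R e" by (simp add: algebra_simps scaleR_2 flip: scaleR_scaleR)
    also have "\<dots> = (diameter L + 2 * r) *\<^sub>R e" using e(2) ab(3) by (simp add: algebra_simps)
    finally show ?thesis using e(1) diameter_ge_0[OF bL] r by (simp add: dist_norm)
  qed
  ultimately show "diameter L + 2 * r \<le> diameter (L + cball 0 r)" by simp
qed

lemma diameter_closed_segment: "diameter (closed_segment a (b::'a::euclidean_space)) = dist a b"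
proof (rule antisym)
  show "diameter (closed_segment a b) \<le> dist a b"
  proof (rule diameter_le)
    fix x y assume "x \<in> closed_segment a b" "y \<in> closed_segment a b"
    then obtain s t where st: "0 \<le> s" "s \<le> 1" "0 \<le> t" "t \<le> 1"
      "x = (1 - s) *\<^sub>R a + s *\<^sub>R b" "y = (1 - t) *\<^sub>R a + t *\<^sub>R b"
      by (auto simp: in_segment)
    have "x - y = (t - s) *\<^sub>R (a - b)" by (simp add: st algebra_simps)
    then have "norm (x - y) = \<bar>t - s\<bar> * dist a b" by (simp add: dist_norm)
    also have "\<dots> \<le> 1 * dist a b" using st by (intro mult_right_mono) auto
    finally show "norm (x - y) \<le> dist a b" by simp
  qed auto
  show "dist a b \<le> diameter (closed_segment a b)"
    by (intro diameter_bounded_bound bounded_closed_segment) auto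
qed

text \<open>The union of the two balls is {a, b} plus a ball, and convex hulls commute with
  Minkowski sums.\<close>

lemma sausage_body_iff:
  "sausage_body lam S \<longleftrightarrow> (\<exists>a b. S = closed_segment a b + cball 0 (1 / lam))"
proof -
  have "convex hull (cball a r \<union> cball b r) = closed_segment a b + cball 0 r" for a b :: 'a and r
  proof -
    have "cball a r \<union> cball b r = {a, b} + cball 0 r"
    proof -
      have "{c} + cball 0 r = cball c r" for c :: 'a
      proof -
        have "{c} + cball 0 r = (+) c ` cball 0 r" unfolding set_plus_def image_def by simp
        then show ?thesis by (simp flip: cball_translation)
      qed
      moreover have "{a, b} = {a} \<union> {b}" by auto
      ultimately show ?thesis by (simp only: Un_set_plus)
    qed
    then show ?thesis
      by (simp only: convex_hull_set_plus segment_convex_hull convex_hull_eq[THEN iffD2, OF convex_cball])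
  qed
  then show ?thesis by (simp add: sausage_body_def)
qed

lemma measure_closed_segment_plus_cball:
  fixes a b :: "'a::euclidean_space"
  assumes t: "0 < t" and \<kappa>: "\<And>w::'a. segm_coeff w = \<kappa> * norm w"
  shows "measure lebesgue (closed_segment a b + cball 0 t)
    = measure lebesgue (cball (0::'a) 1) * t ^ DIM('a) + \<kappa> * dist a b / 2 * t ^ (DIM('a) - 1)"
proof -
  define m w where "m = (1/2) *\<^sub>R (a + b)" and "w = (1/2) *\<^sub>R (b - a)"
  have eq: "closed_segment a b = segm w + {m}"
  proof -
    have im: "(\<lambda>s. 2 * s - 1) ` {0..1} = {-1..1::real}"
      using image_affinity_atLeastAtMost[of 2 "-1" 0 "1::real"] by simp
    have "(1 - s) *\<^sub>R a + s *\<^sub>R b = (2 * s - 1) *\<^sub>R w + m" for s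
    proof -
      have "(2 * s - 1) *\<^sub>R w + m = ((2 * s - 1) / 2) *\<^sub>R (b - a) + (1 / 2) *\<^sub>R (a + b)"
        by (simp add: w_def m_def)
      also have "\<dots> = (1 / 2 - (2 * s - 1) / 2) *\<^sub>R a + ((2 * s - 1) / 2 + 1 / 2) *\<^sub>R b"
        by (simp only: scaleR_add_left scaleR_diff_left scaleR_add_right scaleR_diff_right) simp
      also have "\<dots> = (1 - s) *\<^sub>R a + s *\<^sub>R b"
        by (rule arg_cong2[where f="\<lambda>p q. p *\<^sub>R a + q *\<^sub>R b"]) (auto simp: field_simps)
      finally show ?thesis by simp
    qed
    then have "closed_segment a b = (\<lambda>s. (2 * s - 1) *\<^sub>R w + m) ` {0..1}"
      by (simp add: closed_segment_image_interval)
    also have "\<dots> = (\<lambda>t. t *\<^sub>R w + m) ` {-1..1}" unfolding im[symmetric] image_image ..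
    also have "\<dots> = segm w + {m}" by (auto simp: segm_def set_plus_def)
    finally show ?thesis .
  qed
  have "closed_segment a b + cball 0 t = (cball 0 t + segm w) + {m}" by (simp add: eq ac_simps)
  then have "measure lebesgue (closed_segment a b + cball 0 t) = measure lebesgue (cball 0 t + segm w)"
    by (simp only: measure_translation_singleton)
  also have "\<dots> = measure lebesgue (cball (0::'a) 1) * t ^ DIM('a) + segm_coeff w * t ^ (DIM('a) - 1)"
    by (rule measure_cball_plus_segm[OF t])
  finally show ?thesis by (simp add: \<kappa> w_def dist_norm norm_minus_commute)
qed

section \<open>Comparison of the coefficients of parallel volumes\<close>

lemma shifted_polynomial:
  fixes r t :: real
  shows "(\<Sum>k\<le>N. q k * (r + t) ^ k) = (\<Sum>i\<le>N. (\<Sum>k\<le>N. real (k choose i) * r ^ (k - i) * q k) * t ^ i)"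
proof -
  have "(r + t) ^ k = (\<Sum>i\<le>N. real (k choose i) * t ^ i * r ^ (k - i))" if "k \<le> N" for k
  proof -
    have "(r + t) ^ k = (\<Sum>i\<le>k. real (k choose i) * t ^ i * r ^ (k - i))"
      using binomial_ring[of t r k] by (simp add: add.commute)
    also have "\<dots> = (\<Sum>i\<le>N. real (k choose i) * t ^ i * r ^ (k - i))"
      using that by (intro sum.mono_neutral_left) auto
    finally show ?thesis .
  qed
  then have "(\<Sum>k\<le>N. q k * (r + t) ^ k)
      = (\<Sum>k\<le>N. \<Sum>i\<le>N. q k * (real (k choose i) * t ^ i * r ^ (k - i)))"
    by (simp add: sum_distrib_left)
  also have "\<dots> = (\<Sum>i\<le>N. \<Sum>k\<le>N. q k * (real (k choose i) * t ^ i * r ^ (k - i)))"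
    by (rule sum.swap)
  finally show ?thesis by (simp add: sum_distrib_right sum_distrib_left ac_simps)
qed

text \<open>Because r > 0, the parallel volume of \<open>L\<close> is evaluated only at r + t > 0,
  so its expansion for positive arguments suffices. Terms with k < i vanish through the binomial
  coefficient, so the truncated exponent k - i is harmless.\<close>

lemma quermass_plus_cball:
  fixes L :: "'a::euclidean_space set"
  assumes q: "\<And>t. 0 < t \<Longrightarrow> measure lebesgue (L + cball 0 t) = (\<Sum>k\<le>DIM('a). q k * t ^ k)"
    and r: "0 < r" and i: "i \<le> DIM('a)"
  shows "quermass (L + cball 0 r) i
    = (\<Sum>k\<le>DIM('a). real (k choose i) * r ^ (k - i) * q k) / real (DIM('a) choose i)"
proof (rule quermass_eqI[where q = "\<lambda>i. \<Sum>k\<le>DIM('a). real (k choose i) * r ^ (k - i) * q k", OF _ i])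
  fix t :: real assume t: "0 \<le> t"
  have "L + cball 0 r + cball 0 t = L + cball 0 (r + t)"
    using r t by (simp add: add.assoc cball_plus_cball)
  then show "measure lebesgue (L + cball 0 r + cball 0 t)
      = (\<Sum>i\<le>DIM('a). (\<Sum>k\<le>DIM('a). real (k choose i) * r ^ (k - i) * q k) * t ^ i)"
    using q[of "r + t"] r t by (simp add: shifted_polynomial)
qed

text \<open>Reversing the polynomial by t = 1/s makes the leading coefficient its value at s = 0,
  reached as a limit from the right.\<close>

lemma nonneg_polynomial_lead_coeff:
  fixes d :: "nat \<Rightarrow> real"
  assumes "\<And>t. 0 < t \<Longrightarrow> 0 \<le> (\<Sum>i\<le>N. d i * t ^ i)"
  shows "0 \<le> d N"
proof -
  have nn: "0 \<le> (\<Sum>i\<le>N. d i * s ^ (N - i))" if s: "0 < s" for s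
  proof -
    have "(\<Sum>i\<le>N. d i * s ^ (N - i)) = s ^ N * (\<Sum>i\<le>N. d i * (1 / s) ^ i)"
      unfolding sum_distrib_left using s
      by (intro sum.cong) (auto simp: power_diff power_divide)
    then show ?thesis using assms[of "1 / s"] s by simp
  qed
  have "((\<lambda>s. \<Sum>i\<le>N. d i * s ^ (N - i)) \<longlongrightarrow> (\<Sum>i\<le>N. d i * 0 ^ (N - i))) (at_right 0)"
    by (intro tendsto_intros)
  then have "0 \<le> (\<Sum>i\<le>N. d i * 0 ^ (N - i))"
    by (rule tendsto_lowerbound)
      (use eventually_at_right_less[of "0::real"] nn in \<open>auto elim: eventually_mono\<close>)
  also have "\<dots> = (\<Sum>i\<le>N. if i = N then d i else 0)"
    by (intro sum.cong) auto
  finally show ?thesis by simp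
qed

text \<open>The leading coefficient is bounded above by enclosing \<open>L\<close> in a ball and
  below by the degenerate triangle a, a, a.\<close>

lemma parallel_volume_top_coeffs:
  fixes L :: "'a::euclidean_space set"
  assumes L: "compact_convex L"
    and q: "\<And>t. 0 < t \<Longrightarrow> measure lebesgue (L + cball 0 t) = (\<Sum>k\<le>DIM('a). q k * t ^ k)"
    and \<kappa>: "\<And>w::'a. segm_coeff w = \<kappa> * norm w"
  shows "q DIM('a) = measure lebesgue (cball (0::'a) 1)"
    and "a \<in> L \<Longrightarrow> b \<in> L \<Longrightarrow> x \<in> L \<Longrightarrow>
      \<kappa> * (dist a b + dist a x + dist b x) / 4 \<le> q (DIM('a) - 1)"
proof -
  let ?N = "DIM('a)"
  define \<omega> where "\<omega> = measure lebesgue (cball (0::'a) 1)"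
  obtain M where N: "?N = Suc M" using DIM_positive[where 'a='a] by (metis Suc_pred')
  obtain R where R: "0 < R" "L \<subseteq> cball 0 R"
    using compact_imp_bounded[of L] L unfolding compact_convex_def bounded_pos by (auto simp: subset_iff)
  have perim: "\<omega> * t ^ ?N + \<kappa> * (dist a b + dist a x + dist b x) / 4 * t ^ (?N - 1)
      \<le> (\<Sum>k\<le>?N. q k * t ^ k)" if "a \<in> L" "b \<in> L" "x \<in> L" "0 < t" for a b x t
    using parallel_volume_ge_perimeter[OF L that \<kappa>] q[OF that(4)] by (simp add: \<omega>_def)
  have up: "q ?N \<le> \<omega>"
  proof -
    define p where "p i = \<omega> * (real (?N choose i) * R ^ (?N - i)) - q i" for i
    have "0 \<le> (\<Sum>i\<le>?N. p i * t ^ i)" if t: "0 < t" for t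
    proof -
      have "measure lebesgue (L + cball 0 t) \<le> measure lebesgue (cball 0 R + cball (0::'a) t)"
        using t R by (intro measure_mono_compact_convex set_plus_mono2 compact_convex_plus L compact_convex_cball) auto
      also have "\<dots> = measure lebesgue (cball (0::'a) (t + R))"
        using t R by (simp add: cball_plus_cball add.commute)
      also have "\<dots> = \<omega> * (t + R) ^ ?N"
        unfolding \<omega>_def using t R by (intro measure_cball_scale) auto
      also have "(t + R) ^ ?N = (\<Sum>i\<le>?N. real (?N choose i) * t ^ i * R ^ (?N - i))"
        by (rule binomial_ring)
      finally have "(\<Sum>i\<le>?N. q i * t ^ i) \<le> (\<Sum>i\<le>?N. \<omega> * (real (?N choose i) * t ^ i * R ^ (?N - i)))"
        using q[OF t] by (simp add: sum_distrib_left)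
      moreover have "p i * t ^ i = \<omega> * (real (?N choose i) * t ^ i * R ^ (?N - i)) - q i * t ^ i" for i
        by (simp add: p_def algebra_simps)
      ultimately show ?thesis by (simp add: sum_subtractf)
    qed
    then have "0 \<le> p ?N" by (rule nonneg_polynomial_lead_coeff)
    then show ?thesis by (simp add: p_def)
  qed
  moreover have "\<omega> \<le> q ?N"
  proof -
    obtain a where a: "a \<in> L" using L by (auto simp: compact_convex_def)
    define p where "p i = q i - (if i = ?N then \<omega> else 0)" for i
    have "0 \<le> (\<Sum>i\<le>?N. p i * t ^ i)" if t: "0 < t" for t
      using perim[OF a a a t]
      by (simp add: p_def left_diff_distrib sum_subtractf if_distrib[of "\<lambda>c. c * _"] cong: if_cong)
    then have "0 \<le> p ?N" by (rule nonneg_polynomial_lead_coeff)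
    then show ?thesis by (simp add: p_def)
  qed
  ultimately show eq: "q ?N = measure lebesgue (cball (0::'a) 1)" by (simp add: \<omega>_def)
  \<comment> \<open>With equal leading terms cancelled from the perimeter bound, what remains has
    degree N - 1 and its own leading coefficient can be compared.\<close>
  assume abx: "a \<in> L" "b \<in> L" "x \<in> L"
  define \<rho> where "\<rho> = \<kappa> * (dist a b + dist a x + dist b x) / 4"
  define p where "p i = q i - (if i = M then \<rho> else 0)" for i
  have "0 \<le> (\<Sum>i\<le>M. p i * t ^ i)" if t: "0 < t" for t
  proof -
    have "\<omega> * t ^ Suc M + \<rho> * t ^ M \<le> (\<Sum>k\<le>Suc M. q k * t ^ k)"
      using perim[OF abx t] unfolding N \<rho>_def by simp
    also have "\<dots> = (\<Sum>k\<le>M. q k * t ^ k) + \<omega> * t ^ Suc M" using eq by (simp add: N \<omega>_def)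
    finally have "\<rho> * t ^ M \<le> (\<Sum>k\<le>M. q k * t ^ k)" by simp
    then show ?thesis
      by (simp add: p_def left_diff_distrib sum_subtractf if_distrib[of "\<lambda>c. c * _"] cong: if_cong)
  qed
  then have "0 \<le> p M" by (rule nonneg_polynomial_lead_coeff)
  then show "\<kappa> * (dist a b + dist a x + dist b x) / 4 \<le> q (?N - 1)" by (simp add: p_def N \<rho>_def)
qed

theorem theorem4p1:
  fixes K S :: "'a::euclidean_space set" and lam :: real
  assumes "DIM('a) \<ge> 2"
    and "lam > 0"
    and "convex_body K"
    and "lambda_concave lam K"
    and "sausage_body lam S"
    and "diameter K = diameter S"
  shows "\<forall>i. i \<le> DIM('a) - 1 \<longrightarrow>
           quermass K i \<ge> quermass S i \<and>
           (quermass K i = quermass S i \<longleftrightarrow> sausage_body lam K)"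
proof (intro allI impI)
  fix i assume i: "i \<le> DIM('a) - 1"
  let ?N = "DIM('a)"
  define r where "r = 1 / lam"
  have r: "0 < r" using assms(2) by (simp add: r_def)
  have K: "compact_convex K"
    using assms(3) interior_subset by (fastforce simp: convex_body_def compact_convex_def)
  obtain L where L: "compact_convex L" "K = L + cball 0 r"
    using lambda_concave_decomposition[OF assms(1) K r] assms(4)
    unfolding lambda_concave_def r_def by blast
  have L': "compact L" "L \<noteq> {}" using L(1) by (auto simp: compact_convex_def)
  obtain p0 p1 where S: "S = closed_segment p0 p1 + cball 0 r"
    using assms(5) unfolding sausage_body_iff r_def by blast
  have diam_seg: "diameter (closed_segment a b + cball 0 r) = dist a b + 2 * r" for a b :: 'a
    using r by (simp add: diameter_plus_cball diameter_closed_segment)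
  have diamL: "diameter L = dist p0 p1"
    using assms(6) diam_seg[of p0 p1] diameter_plus_cball[OF L', of r] r by (simp add: S L(2))
  obtain a b where ab: "a \<in> L" "b \<in> L" "dist a b = dist p0 p1"
    using diameter_compact_attained[OF L'] diamL by auto
  obtain \<kappa> where \<kappa>: "0 < \<kappa>" "\<And>w::'a. segm_coeff w = \<kappa> * norm w"
    using segm_coeff_eq_norm by blast
  define \<omega> where "\<omega> = measure lebesgue (cball (0::'a) 1)"
  define W where "W q = (\<Sum>k\<le>?N. real (k choose i) * r ^ (k - i) * q k) / real (?N choose i)"
    for q :: "nat \<Rightarrow> real"
  \<comment> \<open>The coefficients of the parallel volume of a segment of length d; the cases do
    not overlap because N is positive.\<close>
  define s where "s d k = (if k = ?N then \<omega> else if k = ?N - 1 then \<kappa> * d / 2 else 0)" for d k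
  have iN: "i \<le> ?N" and N: "0 < ?N" using i by auto
  have qseg: "quermass (closed_segment u v + cball 0 r) i = W (s (dist u v))" for u v :: 'a
    unfolding W_def
  proof (rule quermass_plus_cball[OF _ r iN])
    fix t :: real assume t: "0 < t"
    obtain M where M: "?N = Suc M" using N by (metis Suc_pred')
    have "(\<Sum>k\<le>?N. s (dist u v) k * t ^ k)
        = (\<Sum>k\<le>M. if k = M then \<kappa> * dist u v / 2 * t ^ M else 0) + \<omega> * t ^ Suc M"
      unfolding M sum.atMost_Suc by (intro arg_cong2[where f="(+)"] sum.cong) (auto simp: s_def M)
    then show "measure lebesgue (closed_segment u v + cball 0 t) = (\<Sum>k\<le>?N. s (dist u v) k * t ^ k)"
      using measure_closed_segment_plus_cball[OF t \<kappa>(2), of u v] by (simp add: M \<omega>_def)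
  qed
  obtain q where q: "\<And>k. k \<le> ?N \<Longrightarrow> 0 \<le> q k"
    "\<And>t. 0 \<le> t \<Longrightarrow> measure lebesgue (L + cball 0 t) = (\<Sum>k\<le>?N. q k * t ^ k)"
    using steiner_polynomial[OF L(1)] by blast
  have qK: "quermass K i = W q"
    unfolding W_def L(2) by (rule quermass_plus_cball[OF _ r iN]) (simp add: q(2))
  have qS: "quermass S i = W (s (dist a b))" unfolding S qseg ab(3) ..
  have top: "q ?N = \<omega>"
    unfolding \<omega>_def by (intro parallel_volume_top_coeffs(1)[OF L(1) _ \<kappa>(2)]) (auto simp: q(2))
  have sec: "\<kappa> * (dist a b + dist a x + dist b x) / 4 \<le> q (?N - 1)" if "x \<in> L" for x
    using ab(1,2) that
    by (intro parallel_volume_top_coeffs(2)[OF L(1) _ \<kappa>(2)]) (auto simp: q(2))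
  \<comment> \<open>At k = N - 1 the degenerate triangle a, b, b has perimeter 2 |ab|, which matches
    the segment exactly; below that the segment contributes 0.\<close>
  have ge: "s (dist a b) k \<le> q k" if "k \<le> ?N" for k
    using top sec[OF ab(2)] q(1)[OF that] by (auto simp: s_def dist_commute)
  have term_ge: "real (k choose i) * r ^ (k - i) * s (dist a b) k \<le> real (k choose i) * r ^ (k - i) * q k"
    if "k \<le> ?N" for k
    using ge[OF that] r by (intro mult_left_mono) auto
  have choose: "0 < real (?N choose i)" using iN by simp
  have le: "quermass S i \<le> quermass K i"
    unfolding qK qS W_def using choose term_ge by (intro divide_right_mono sum_mono) auto
  have "sausage_body lam K" if eq: "quermass K i = quermass S i"
  proof -
    have "(\<Sum>k\<le>?N. real (k choose i) * r ^ (k - i) * s (dist a b) k)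
        = (\<Sum>k\<le>?N. real (k choose i) * r ^ (k - i) * q k)"
      using eq choose unfolding qK qS W_def by simp
    then have "real (?N - 1 choose i) * r ^ (?N - 1 - i) * s (dist a b) (?N - 1)
        = real (?N - 1 choose i) * r ^ (?N - 1 - i) * q (?N - 1)"
      by (rule sum_mono_inv) (auto intro: term_ge)
    \<comment> \<open>This weight is nonzero because i is at most N - 1, so equality of the sums
      reaches the coefficient of t^(N-1).\<close>
    moreover have "real (?N - 1 choose i) * r ^ (?N - 1 - i) \<noteq> 0" using i r by simp
    ultimately have "q (?N - 1) = s (dist a b) (?N - 1)" by (metis mult_left_cancel)
    also have "\<dots> = \<kappa> * dist a b / 2"
    proof -
      have "?N - 1 \<noteq> ?N" using N by linarith
      then show ?thesis by (simp add: s_def)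
    qed
    finally have sec_eq: "q (?N - 1) = \<kappa> * dist a b / 2" .
    have "x \<in> closed_segment a b" if x: "x \<in> L" for x
    proof -
      \<comment> \<open>No triangle a, b, x with \<open>x\<close> in \<open>L\<close> may have
        perimeter above 2 |ab|, so the triangle inequality is an equality and x lies between a and
        b.\<close>
      have "\<kappa> * (dist a b + dist a x + dist b x) / 4 \<le> \<kappa> * dist a b / 2"
        using sec[OF x] sec_eq by simp
      then have "\<kappa> * (dist a x + dist b x) \<le> \<kappa> * dist a b" by (simp add: algebra_simps)
      then have "dist a x + dist x b \<le> dist a b" using \<kappa>(1) by (simp add: dist_commute)
      then have "dist a b = dist a x + dist x b" using dist_triangle[of a b x] by simp
      then show ?thesis by (simp add: between flip: between_mem_segment)
    qed
    moreover have "closed_segment a b \<subseteq> L"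
      using ab L(1) by (simp add: closed_segment_subset compact_convex_def)
    ultimately have "L = closed_segment a b" by blast
    then show ?thesis unfolding sausage_body_iff L(2) r_def by blast
  qed
  moreover have "quermass K i = quermass S i" if saus: "sausage_body lam K"
  proof -
    obtain u v where uv: "K = closed_segment u v + cball 0 r"
      using saus unfolding sausage_body_iff r_def by blast
    \<comment> \<open>The coefficients for a segment depend on its length only, and the diameter
      fixes this length.\<close>
    have "dist u v = dist p0 p1"
      using assms(6) diam_seg[of u v] diam_seg[of p0 p1] by (simp add: uv S)
    then show ?thesis unfolding uv S qseg by simp
  qed
  ultimately show "quermass K i \<ge> quermass S i \<and> (quermass K i = quermass S i \<longleftrightarrow> sausage_body lam K)"
    using le by blast
qed

end
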